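(* Let $u\in L^2_\mu(\mathcal X)$, let $M\ge1$ and $n_{min}\in\{1,\dots,n\}$ be integers, let $\delta\in(0,1)$ and $\eta\in(0,1)$, and assume $n\ge n(\delta,\eta,m):=d_\delta^{-1}\,m\log(2m\eta^{-1})$, where $d_\delta=-\delta+(1+\delta)\log(1+\delta)$. Let $\widetilde{\bm x}^n_K$ be the subsample produced by the greedy algorithm (see context) from a sample $\widetilde{\bm x}^n\sim\widetilde{\bm\rho}^n$, with $\#K\ge n_{min}$. Then the weighted least-squares projection $Q_{V_m}^{\widetilde{\bm x}^n_K}u$ satisfies $$\mathbb E\big(\|u-Q_{V_m}^{\widetilde{\bm x}^n_K}u\|^2\big)\le\Big(1+\frac{n}{n_{min}}(1-\delta)^{-1}(1-\eta^M)^{-1}M\Big)\|u-P_{V_m}u\|^2 .$$ Moreover, if $\|u\|_{\infty,w}\le L$, then $$\mathbb E\big(\|u-Q_{V_m}^{\widetilde{\bm x}^n_K}u\|^2\big)\le\|u-P_{V_m}u\|^2+\frac{n}{n_{min}}(1-\delta)^{-1}(1-\eta^M)^{-1}D\big(M,L,m,\|u-P_{V_m}u\|^2\big),$$ where, for all $\alpha\ge0$, $$D(M,L,m,\alpha)=\inf_{0<\varepsilon\le 1} C(\varepsilon,M)\,\big(L(1+c_m)\big)^{2-2\varepsilon}\alpha^{\varepsilon},\qquad C(\varepsilon,M)=M\frac{(1-\varepsilon)^{1-\varepsilon}}{(M-\varepsilon)^{1-\varepsilon}}$$ (with $C(1,M)=M$), and $c_m$ is the supremum of $\|P_{V_m}v\|_{\infty,w}$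 over functions $v\in L^2_\mu(\mathcal X)$ with $\|v\|_{\infty,w}\le1$.
   Context: Setting: $\mathcal X\subset\mathbb R^d$ is equipped with a probability measure $\mu$; $L^2_\mu(\mathcal X)$ is the space of square-integrable real-valued functions, with norm $\|\cdot\|$ and inner product $(\cdot,\cdot)$; functions are regarded as defined pointwise. $V_m\subset L^2_\mu(\mathcal X)$ is a subspace of dimension $m\ge1$ with orthonormal basis $\varphi_1,\dots,\varphi_m$, and $\bm\varphi(x)=(\varphi_1(x),\dots,\varphi_m(x))^T$. $P_{V_m}v=\sum_j (v,\varphi_j)\varphi_j$ is the $L^2_\mu$-orthogonal projection onto $V_m$. Weight: $w$ is defined by $w(x)^{-1}=\frac1m\sum_{j=1}^m\varphi_j(x)^2$ (where this vanishes, set $w(x)=0$). $\rho$ is the probability measure $d\rho=w^{-1}d\mu$ and $\bm\rho^n=\rho^{\otimes n}$. $\|v\|_{\infty,w}=\sup_{x\in\mathcal X}w(x)^{1/2}|v(x)|$. For a finite sample $\bm x=(x^i)_{i\in I}$ of points in $\mathcal X$: $\|v\|_{\bm x}^2=\frac1{\#I}\sum_{i\in I} w(x^i)v(x^i)^2$; $\bm G_{\bm x}=\frac1{\#I}\sum_{i\in I} w(x^i)\bm\varphi(x^i)\bm\varphi(x^i)^T$; $Z_{\bm x}=\|\bm G_{\bm x}-\bm I\|_2$ (spectral norm); $Q^{\bm x}_{V_m}u=\arg\min_{v\in V_m}\|u-v\|_{\bm x}$ (unique when $Z_{\bm x}<1$). Sampling: draw $M$ independent samples $\bm x^{n,1},\dots,\bm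 x^{n,M}$ from $\bm\rho^n$, and let $\bm x^{n,\star}$ be one of them minimizing $Z_{\bm x^{n,i}}$ over $1\le i\le M$, chosen uniformly at random among the minimizers in case of ties. $\widetilde{\bm\rho}^n$ is the distribution of $\bm x^{n,\star}$ conditioned on the event $A_\delta=\{Z_{\bm x^{n,\star}}\le\delta\}$. Greedy algorithm: given $\widetilde{\bm x}^n=(\widetilde x^1,\dots,\widetilde x^n)\sim\widetilde{\bm\rho}^n$ (so $Z_{\widetilde{\bm x}^n}\le\delta$), for $K\subset\{1,\dots,n\}$ write $\widetilde{\bm x}^n_K=(\widetilde x^k)_{k\in K}$. Start with $K=\{1,\dots,n\}$. At each step select $k^\star\in K$ minimizing $\|\bm G_{\widetilde{\bm x}^n_{K\setminus\{k\}}}-\bm I\|_2$ over $k\in K$; if $\|\bm G_{\widetilde{\bm x}^n_{K\setminus\{k^\star\}}}-\bm I\|_2\le\delta$ and $\#K>n_{min}$, remove $k^\star$ from $K$ and continue; otherwise stop. The output satisfies $Z_{\widetilde{\bm x}^n_K}\le\delta$ and $\#K\ge n_{min}$. *)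

theory Defs
  imports "HOL-Probability.Probability"
begin

text \<open>
  The basis functions are indexed by a finite type, so the dimension \<open>m\<close> of \<open>V\<^sub>m\<close> is
  \<open>CARD('m)\<close>.  Functions on \<open>X = space \<mu>\<close> are total HOL functions that are not identified
  when they agree almost everywhere; their values outside \<open>X\<close> are irrelevant.
\<close>

definition L2_space :: "'a measure \<Rightarrow> ('a \<Rightarrow> real) set" where
  "L2_space \<mu> = {v \<in> borel_measurable \<mu>. integrable \<mu> (\<lambda>x. (v x)\<^sup>2)}"

definition L2_inner :: "'a measure \<Rightarrow> ('a \<Rightarrow> real) \<Rightarrow> ('a \<Rightarrow> real) \<Rightarrow> real" where
  "L2_inner \<mu> v v' = (\<integral>x. v x * v' x \<partial>\<mu>)"

definition L2_norm :: "'a measure \<Rightarrow> ('a \<Rightarrow> real) \<Rightarrow> real" where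
  "L2_norm \<mu> v = sqrt (\<integral>x. (v x)\<^sup>2 \<partial>\<mu>)"

definition L2_orthonormal :: "'a measure \<Rightarrow> ('m::finite \<Rightarrow> 'a \<Rightarrow> real) \<Rightarrow> bool" where
  "L2_orthonormal \<mu> \<phi> \<longleftrightarrow>
     (\<forall>j. \<phi> j \<in> L2_space \<mu>) \<and> (\<forall>j k. L2_inner \<mu> (\<phi> j) (\<phi> k) = (if j = k then 1 else 0))"

definition basis_span :: "('m::finite \<Rightarrow> 'a \<Rightarrow> real) \<Rightarrow> ('a \<Rightarrow> real) set" where
  "basis_span \<phi> = range (\<lambda>c x. \<Sum>j\<in>UNIV. c j * \<phi> j x)"

definition L2_proj :: "'a measure \<Rightarrow> ('m::finite \<Rightarrow> 'a \<Rightarrow> real) \<Rightarrow> ('a \<Rightarrow> real) \<Rightarrow> 'a \<Rightarrow> real" where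
  "L2_proj \<mu> \<phi> v = (\<lambda>x. \<Sum>j\<in>UNIV. L2_inner \<mu> v (\<phi> j) * \<phi> j x)"

text \<open>
  Since \<open>inverse 0 = 0\<close>, the weight is 0 where all basis functions vanish, and
  \<open>inverse (weight \<phi> x)\<close> is the mean of the \<open>(\<phi> j x)\<^sup>2\<close> at every \<open>x\<close>.
\<close>
definition weight :: "('m::finite \<Rightarrow> 'a \<Rightarrow> real) \<Rightarrow> 'a \<Rightarrow> real" where
  "weight \<phi> x = inverse (1 / real CARD('m) * (\<Sum>j\<in>UNIV. (\<phi> j x)\<^sup>2))"

definition rho :: "'a measure \<Rightarrow> ('m::finite \<Rightarrow> 'a \<Rightarrow> real) \<Rightarrow> 'a measure" where
  "rho \<mu> \<phi> = density \<mu> (\<lambda>x. ennreal (inverse (weight \<phi> x)))"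

definition rho_n :: "'a measure \<Rightarrow> ('m::finite \<Rightarrow> 'a \<Rightarrow> real) \<Rightarrow> nat \<Rightarrow> (nat \<Rightarrow> 'a) measure" where
  "rho_n \<mu> \<phi> n = PiM {1..n} (\<lambda>_. rho \<mu> \<phi>)"

definition wsup_norm :: "'a measure \<Rightarrow> ('m::finite \<Rightarrow> 'a \<Rightarrow> real) \<Rightarrow> ('a \<Rightarrow> real) \<Rightarrow> ereal" where
  "wsup_norm \<mu> \<phi> v = (SUP x\<in>space \<mu>. ereal (sqrt (weight \<phi> x) * \<bar>v x\<bar>))"

text \<open>
  For a probability measure and an orthonormal system this supremum is at most
  \<open>sqrt (real CARD('m))\<close> by the Cauchy-Schwarz and Bessel inequalities, so the conversion
  \<open>real_of_ereal\<close> never meets an infinite value there.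
\<close>
definition proj_const :: "'a measure \<Rightarrow> ('m::finite \<Rightarrow> 'a \<Rightarrow> real) \<Rightarrow> real" where
  "proj_const \<mu> \<phi> = real_of_ereal
     (SUP v\<in>{v \<in> L2_space \<mu>. wsup_norm \<mu> \<phi> v \<le> 1}. wsup_norm \<mu> \<phi> (L2_proj \<mu> \<phi> v))"

text \<open>A finite sample is a family \<open>x\<close> of points together with its finite index set \<open>I\<close>.\<close>

definition emp_norm ::
  "('m::finite \<Rightarrow> 'a \<Rightarrow> real) \<Rightarrow> (nat \<Rightarrow> 'a) \<Rightarrow> nat set \<Rightarrow> ('a \<Rightarrow> real) \<Rightarrow> real" where
  "emp_norm \<phi> x I v = sqrt (1 / real (card I) * (\<Sum>i\<in>I. weight \<phi> (x i) * (v (x i))\<^sup>2))"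

definition gram ::
  "('m::finite \<Rightarrow> 'a \<Rightarrow> real) \<Rightarrow> (nat \<Rightarrow> 'a) \<Rightarrow> nat set \<Rightarrow> real^'m^'m" where
  "gram \<phi> x I =
     (1 / real (card I)) *\<^sub>R (\<Sum>i\<in>I. weight \<phi> (x i) *\<^sub>R (\<chi> j k. \<phi> j (x i) * \<phi> k (x i)))"

definition Zdev :: "('m::finite \<Rightarrow> 'a \<Rightarrow> real) \<Rightarrow> (nat \<Rightarrow> 'a) \<Rightarrow> nat set \<Rightarrow> real" where
  "Zdev \<phi> x I = onorm ((*v) (gram \<phi> x I - mat 1))"

text \<open>The minimizer is unique (as a function) whenever \<open>Zdev \<phi> x I < 1\<close>.\<close>
definition lsq_proj ::
  "('m::finite \<Rightarrow> 'a \<Rightarrow> real) \<Rightarrow> (nat \<Rightarrow> 'a) \<Rightarrow> nat set \<Rightarrow> ('a \<Rightarrow> real) \<Rightarrow> 'a \<Rightarrow> real" where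
  "lsq_proj \<phi> x I u = arg_min_on (\<lambda>v. emp_norm \<phi> x I (\<lambda>t. u t - v t)) (basis_span \<phi>)"

definition best_indices ::
  "('m::finite \<Rightarrow> 'a \<Rightarrow> real) \<Rightarrow> nat \<Rightarrow> nat \<Rightarrow> (nat \<Rightarrow> nat \<Rightarrow> 'a) \<Rightarrow> nat set" where
  "best_indices \<phi> n M y = {i. is_arg_min (\<lambda>i. Zdev \<phi> (y i) {1..n}) (\<lambda>i. i \<in> {1..M}) i}"

text \<open>
  Law of the best of \<open>M\<close> independent samples \<open>y 1, \<dots>, y M\<close> of size \<open>n\<close>: given \<open>y\<close>, an index
  is drawn uniformly among the minimizers.
\<close>
definition rho_star ::
  "'a measure \<Rightarrow> ('m::finite \<Rightarrow> 'a \<Rightarrow> real) \<Rightarrow> nat \<Rightarrow> nat \<Rightarrow> (nat \<Rightarrow> 'a) measure" where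
  "rho_star \<mu> \<phi> n M =
     PiM {1..M} (\<lambda>_. rho_n \<mu> \<phi> n) \<bind>
       (\<lambda>y. distr (measure_pmf (pmf_of_set (best_indices \<phi> n M y))) (rho_n \<mu> \<phi> n) (\<lambda>i. y i))"

text \<open>\<open>uniform_measure\<close> is conditioning on an event: it maps \<open>B\<close> to \<open>P (A \<inter> B) / P A\<close>.\<close>
definition rho_tilde ::
  "'a measure \<Rightarrow> ('m::finite \<Rightarrow> 'a \<Rightarrow> real) \<Rightarrow> nat \<Rightarrow> nat \<Rightarrow> real \<Rightarrow> (nat \<Rightarrow> 'a) measure" where
  "rho_tilde \<mu> \<phi> n M \<delta> =
     uniform_measure (rho_star \<mu> \<phi> n M) {x \<in> space (rho_n \<mu> \<phi> n). Zdev \<phi> x {1..n} \<le> \<delta>}"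

text \<open>
  Ties between minimizers \<open>k\<close> may be resolved in any way, so one greedy step is a relation.
  Whether a step is possible does not depend on the choice of the minimizer.
\<close>
definition greedy_step ::
  "('m::finite \<Rightarrow> 'a \<Rightarrow> real) \<Rightarrow> real \<Rightarrow> nat \<Rightarrow> (nat \<Rightarrow> 'a) \<Rightarrow> nat set \<Rightarrow> nat set \<Rightarrow> bool" where
  "greedy_step \<phi> \<delta> n\<^sub>m\<^sub>i\<^sub>n x K K' \<longleftrightarrow>
     (\<exists>k. is_arg_min (\<lambda>k. Zdev \<phi> x (K - {k})) (\<lambda>k. k \<in> K) k \<and>
          Zdev \<phi> x (K - {k}) \<le> \<delta> \<and> card K > n\<^sub>m\<^sub>i\<^sub>n \<and> K' = K - {k})"

definition greedy_output ::
  "('m::finite \<Rightarrow> 'a \<Rightarrow> real) \<Rightarrow> real \<Rightarrow> nat \<Rightarrow> nat \<Rightarrow> (nat \<Rightarrow> 'a) \<Rightarrow> nat set \<Rightarrow> bool" where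
  "greedy_output \<phi> \<delta> n\<^sub>m\<^sub>i\<^sub>n n x K \<longleftrightarrow>
     (greedy_step \<phi> \<delta> n\<^sub>m\<^sub>i\<^sub>n x)\<^sup>*\<^sup>* {1..n} K \<and> (\<nexists>K'. greedy_step \<phi> \<delta> n\<^sub>m\<^sub>i\<^sub>n x K K')"

definition d_const :: "real \<Rightarrow> real" where
  "d_const \<delta> = - \<delta> + (1 + \<delta>) * ln (1 + \<delta>)"

definition n_bound :: "real \<Rightarrow> real \<Rightarrow> nat \<Rightarrow> real" where
  "n_bound \<delta> \<eta> m = inverse (d_const \<delta>) * real m * ln (2 * real m * inverse \<eta>)"

text \<open>
  Real power with the convention that the zeroth power is 1, also for base 0 (whereas
  \<open>0 powr 0 = 0\<close>).  It makes \<open>C_const 1 M = M\<close>.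
\<close>
definition rpow :: "real \<Rightarrow> real \<Rightarrow> real" where
  "rpow b a = (if a = 0 then 1 else b powr a)"

definition C_const :: "real \<Rightarrow> nat \<Rightarrow> real" where
  "C_const \<epsilon> M = real M * (rpow (1 - \<epsilon>) (1 - \<epsilon>) / rpow (real M - \<epsilon>) (1 - \<epsilon>))"

text \<open>The dependence on \<open>m\<close> is through the argument \<open>c\<close>, which stands for \<open>c\<^sub>m\<close>.\<close>
definition D_const :: "nat \<Rightarrow> real \<Rightarrow> real \<Rightarrow> real \<Rightarrow> real" where
  "D_const M L c \<alpha> =
     (INF \<epsilon>\<in>{0<..1}. C_const \<epsilon> M * rpow (L * (1 + c)) (2 - 2 * \<epsilon>) * rpow \<alpha> \<epsilon>)"

end

theory Submission
  imports Defs
begin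

text \<open>
  Write \<open>m\<close> for the dimension, \<open>g = u - P u\<close> for the residual of the orthogonal projection and \<open>Z\<close>
  for the deviation of the Gram matrix of the full sample from the identity.

  \<^bold>\<open>Stability.\<close>  If the Gram matrix of the selected subsample is within \<open>\<delta>\<close> of the identity, then the
  squared error of the weighted least-squares projection exceeds \<open>\<parallel>g\<parallel>\<^sup>2\<close> by at most
  \<open>1 / (1 - \<delta>)\<close> times the squared empirical norm of \<open>g\<close> on the subsample (\<open>lsq_proj_error_le\<close>).  This
  square is in turn at most \<open>n / n\<^sub>m\<^sub>i\<^sub>n\<close> times the one on the full sample, however the subsample
  was chosen.  It remains to bound the expectation of the squared empirical norm \<open>Y\<close>
  of \<open>g\<close> over the conditioned law of the full sample.

  \<^bold>\<open>Conditioning.\<close>  Conditioning on \<open>Z \<le> \<delta>\<close> costs the factor \<open>1 / P (Z \<le> \<delta>)\<close>.  The best of \<open>M\<close> samples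
  fails only if all of them fail, so this probability is at least \<open>1 - \<eta> ^ M\<close> once a single sample fails with
  probability at most \<open>\<eta>\<close> (\<open>prob_best_law_gt_le\<close>).

  \<^bold>\<open>Matrix Chernoff bound.\<close>  The Gram matrix is an average of \<open>m v v\<^sup>T\<close> for independent isotropic unit
  vectors \<open>v\<close>.  The exponential moment method needs \<open>E tr (exp (H + s v v\<^sup>T))\<close> to be bounded through
  \<open>tr (exp H)\<close>, usually by the Golden-Thompson inequality.  For rank-one summands an elementary argument with the
  powers \<open>(1 + H / N) ^ N\<close> in place of exponentials suffices (\<open>tr_power_rank_one_update\<close>): the derivative of the
  trace along \<open>v v\<^sup>T\<close> is a multiple of a moment of the operator at \<open>v\<close>, and moments satisfy Chebyshev's
  inequality \<open>h i * h j \<le> h (i + j)\<close>.  Taking expectations compares the trace with a binomial random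
  variable, and \<open>N \<rightarrow> \<infinity>\<close> gives the constant \<open>d\<^sub>\<delta>\<close> for both tails
  (\<open>prob_Zdev_gt_le\<close>).

  \<^bold>\<open>The selected sample.\<close>  Before conditioning it is one of \<open>M\<close> samples, so \<open>E Y \<le> M \<parallel>g\<parallel>\<^sup>2\<close>, which is the first
  bound.  If the weighted supremum norm of \<open>u\<close> is at most \<open>L\<close>, then \<open>Y \<le> B = (L (1 + c\<^sub>m))\<^sup>2\<close>, and the
  maximum of \<open>M\<close> independent copies of \<open>Y\<close> is at most \<open>B (1 - \<Prod>\<^sub>i (1 - Y\<^sub>i / B))\<close>.  Hence
  \<open>E Y \<le> B (1 - (1 - \<beta>) ^ M)\<close>, where \<open>\<beta> \<le> \<parallel>g\<parallel>\<^sup>2 / B\<close> is the mean of a single copy divided by \<open>B\<close>.  For every \<open>\<epsilon>\<close> this is at most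
  \<open>C(\<epsilon>, M) B\<^sup>1\<^sup>-\<^sup>\<epsilon> \<parallel>g\<parallel>\<^sup>2\<^sup>\<epsilon>\<close> by Hoelder's inequality (\<open>best_of_M_scalar\<close>), which is the second bound.
\<close>

section \<open>Positive semidefinite operators and rank-one updates\<close>

definition selfadjoint :: "('e::euclidean_space \<Rightarrow> 'e) \<Rightarrow> bool" where
  "selfadjoint F \<longleftrightarrow> linear F \<and> (\<forall>x y. F x \<bullet> y = x \<bullet> F y)"

definition psd :: "('e::euclidean_space \<Rightarrow> 'e) \<Rightarrow> bool" where
  "psd F \<longleftrightarrow> selfadjoint F \<and> (\<forall>x. 0 \<le> x \<bullet> F x)"

definition tr :: "('e::euclidean_space \<Rightarrow> 'e) \<Rightarrow> real" where
  "tr F = (\<Sum>b\<in>Basis. b \<bullet> F b)"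

lemma linear_funpow: "linear F \<Longrightarrow> linear (F ^^ k)" for F :: "'e::euclidean_space \<Rightarrow> 'e"
  by (induction k) (auto simp: linear_compose linear_id[unfolded id_def] id_def)

lemma selfadjoint_funpow:
  assumes "selfadjoint F"
  shows "(F ^^ k) x \<bullet> y = x \<bullet> (F ^^ k) y"
  using assms by (induction k arbitrary: x y) (auto simp: selfadjoint_def funpow_swap1)

lemma moment_add:
  assumes "selfadjoint F"
  shows "x \<bullet> (F ^^ (i + j)) y = (F ^^ i) x \<bullet> (F ^^ j) y"
  by (simp add: selfadjoint_funpow[OF assms] funpow_add)

lemma psd_Cauchy_Schwarz:
  assumes "psd F"
  shows "(x \<bullet> F y)\<^sup>2 \<le> (x \<bullet> F x) * (y \<bullet> F y)"
proof -
  have lin: "linear F" and sym: "y \<bullet> F x = x \<bullet> F y" for x y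
    using assms by (auto simp: psd_def selfadjoint_def) (metis inner_commute)
  have "0 \<le> (x + t *\<^sub>R y) \<bullet> F (x + t *\<^sub>R y)" for t
    using assms by (auto simp: psd_def)
  then have quad: "0 \<le> (y \<bullet> F y) * t\<^sup>2 + 2 * (x \<bullet> F y) * t + x \<bullet> F x" for t
    by (simp add: linear_add[OF lin] linear_scale[OF lin] inner_add_left inner_add_right sym[of y x]
        power2_eq_square algebra_simps)
  show ?thesis
  proof (cases "y \<bullet> F y = 0")
    case True
    have "x \<bullet> F y = 0"
    proof (rule ccontr)
      assume "x \<bullet> F y \<noteq> 0"
      then show False
        using quad[of "- (x \<bullet> F x + 1) / (2 * (x \<bullet> F y))"] True by (simp add: field_simps)
    qed
    then show ?thesis using True by simp
  next
    case False
    then have pos: "y \<bullet> F y > 0" using assms by (simp add: psd_def less_le)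
    show ?thesis
      using quad[of "- (x \<bullet> F y) / (y \<bullet> F y)"] pos
      by (simp add: field_simps power2_eq_square)
  qed
qed

lemma psd_moment_nonneg:
  assumes "psd F"
  shows "0 \<le> v \<bullet> (F ^^ k) v"
proof -
  have sa: "selfadjoint F" using assms by (simp add: psd_def)
  show ?thesis
  proof (cases "even k")
    case True
    then obtain l where "k = l + l" by (auto elim!: evenE simp: mult_2)
    then show ?thesis by (simp add: moment_add[OF sa])
  next
    case False
    then obtain l where "k = l + Suc l" by (auto elim!: oddE simp: mult_2)
    then show ?thesis using assms by (simp add: moment_add[OF sa] psd_def del: add_Suc_right)
  qed
qed

text \<open>
  For \<open>x = (F ^^ l) v\<close> three consecutive moments are values of one semi-inner product, the
  Euclidean one or the one induced by \<open>F\<close>, depending on the parity of \<open>k\<close>; so this is an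
  instance of the Cauchy-Schwarz inequality, and no spectral decomposition is involved.
\<close>
lemma psd_moment_log_convex:
  assumes "psd F"
  shows "(v \<bullet> (F ^^ Suc k) v)\<^sup>2 \<le> (v \<bullet> (F ^^ k) v) * (v \<bullet> (F ^^ Suc (Suc k)) v)"
proof -
  have sa: "selfadjoint F" using assms by (simp add: psd_def)
  note m = moment_add[OF sa]
  show ?thesis
  proof (cases "even k")
    case True
    then obtain l where l: "k = l + l" by (auto elim!: evenE simp: mult_2)
    define x where "x = (F ^^ l) v"
    have "v \<bullet> (F ^^ k) v = x \<bullet> x" "v \<bullet> (F ^^ Suc k) v = x \<bullet> F x"
      "v \<bullet> (F ^^ Suc (Suc k)) v = F x \<bullet> F x"
      using m[of v l l] m[of v l "Suc l"] m[of v "Suc l" "Suc l"] by (simp_all add: l x_def)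
    then show ?thesis by (simp add: Cauchy_Schwarz_ineq del: funpow.simps)
  next
    case False
    then obtain l where l: "k = l + Suc l" by (auto elim!: oddE simp: mult_2)
    define x where "x = (F ^^ l) v"
    have "v \<bullet> (F ^^ k) v = x \<bullet> F x" "v \<bullet> (F ^^ Suc k) v = x \<bullet> F (F x)"
      "v \<bullet> (F ^^ Suc (Suc k)) v = F x \<bullet> F (F x)"
      using m[of v l "Suc l"] m[of v l "Suc (Suc l)"] m[of v "Suc l" "Suc (Suc l)"]
      by (simp_all add: l x_def)
    then show ?thesis
      using psd_Cauchy_Schwarz[OF assms, of x "F x"] by (simp del: funpow.simps)
  qed
qed

text \<open>
  Log-convexity says that the ratios \<open>h (k + 1) / h k\<close> increase, so a unit of index may be
  moved from the smaller of two indices to the larger one without decreasing the product.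
  Zeros of \<open>h\<close> are the reason for arguing with products instead of ratios.
\<close>
lemma log_convex_seq_mult_le:
  fixes h :: "nat \<Rightarrow> real"
  assumes nonneg: "\<And>k. 0 \<le> h k" and lc: "\<And>k. (h (Suc k))\<^sup>2 \<le> h k * h (Suc (Suc k))"
  shows "h i * h j \<le> h 0 * h (i + j)"
proof -
  have shift: "h (Suc i) * h (i + d) \<le> h i * h (Suc (i + d))" for i d
  proof (induction d)
    case (Suc d)
    let ?j = "i + d"
    show ?case
    proof (cases "h (Suc ?j) = 0")
      case True
      then show ?thesis using nonneg by simp
    next
      case False
      then have "h ?j \<noteq> 0" using lc[of ?j] by auto
      then have pos: "0 < h ?j" using nonneg[of ?j] by simp
      have "h ?j * (h (Suc i) * h (Suc ?j)) = (h (Suc i) * h ?j) * h (Suc ?j)" by simp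
      also have "\<dots> \<le> (h i * h (Suc ?j)) * h (Suc ?j)"
        using Suc nonneg by (intro mult_right_mono) auto
      also have "\<dots> = h i * (h (Suc ?j))\<^sup>2" by (simp add: power2_eq_square)
      also have "\<dots> \<le> h i * (h ?j * h (Suc (Suc ?j)))"
        using lc nonneg by (intro mult_left_mono) auto
      finally have "h ?j * (h (Suc i) * h (Suc ?j)) \<le> h ?j * (h i * h (Suc (Suc ?j)))"
        by (simp add: ac_simps)
      then show ?thesis using pos by simp
    qed
  qed simp
  have le: "h i * h j \<le> h 0 * h (i + j)" if "i \<le> j" for i j
    using that
  proof (induction i arbitrary: j)
    case (Suc i)
    have "h (Suc i) * h j \<le> h i * h (Suc j)" using shift[of i "j - i"] Suc.prems by simp
    also have "\<dots> \<le> h 0 * h (i + Suc j)" using Suc.prems by (intro Suc.IH) simp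
    finally show ?case by simp
  qed simp
  show ?thesis using le[of i j] le[of j i] by (cases "i \<le> j") (auto simp: ac_simps)
qed

text \<open>
  This is Chebyshev's association inequality: the moments are those of the spectral
  distribution of \<open>v\<close>, a probability measure on the nonnegative reals, on which powers are
  increasing and therefore positively correlated.
\<close>
lemma psd_moment_mult_le:
  assumes "psd F" "norm v = 1"
  shows "(v \<bullet> (F ^^ i) v) * (v \<bullet> (F ^^ j) v) \<le> v \<bullet> (F ^^ (i + j)) v"
  using log_convex_seq_mult_le[of "\<lambda>k. v \<bullet> (F ^^ k) v" i j, OF psd_moment_nonneg psd_moment_log_convex]
    assms by (simp add: dot_square_norm)

lemma psd_moment_power_le:
  assumes "psd F" "norm x = 1"
  shows "(x \<bullet> F x) ^ k \<le> x \<bullet> (F ^^ k) x"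
proof (induction k)
  case 0
  then show ?case using assms by (simp add: dot_square_norm)
next
  case (Suc k)
  have "(x \<bullet> F x) ^ Suc k \<le> (x \<bullet> F x) * (x \<bullet> (F ^^ k) x)"
    using Suc assms by (simp add: mult_left_mono psd_def)
  also have "\<dots> \<le> x \<bullet> (F ^^ Suc k) x" using psd_moment_mult_le[OF assms, of 1 k] by simp
  finally show ?case .
qed

lemma tr_funpow_nonneg: "psd F \<Longrightarrow> 0 \<le> tr (F ^^ k)"
  unfolding tr_def by (intro sum_nonneg psd_moment_nonneg)

lemma psd_funpow:
  assumes "psd F" shows "psd (F ^^ k)"
  using assms psd_moment_nonneg[OF assms]
  by (auto simp: psd_def selfadjoint_def[of "F ^^ k"] selfadjoint_funpow)
    (auto simp: selfadjoint_def linear_funpow)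

text \<open>
  The trace dominates the largest eigenvalue; the Cauchy-Schwarz inequality for the form of
  \<open>F\<close>, applied to \<open>x\<close> and the basis vectors, replaces the passage to an eigenbasis.
\<close>
lemma quadratic_form_le_tr:
  assumes "psd F" "norm x = 1"
  shows "x \<bullet> F x \<le> tr F"
proof (cases "x \<bullet> F x = 0")
  case True
  then show ?thesis using assms by (simp add: tr_def psd_def sum_nonneg)
next
  case False
  then have pos: "0 < x \<bullet> F x" using assms by (simp add: psd_def less_le)
  have "(x \<bullet> F x)\<^sup>2 \<le> F x \<bullet> F x"
    using Cauchy_Schwarz_ineq[of x "F x"] assms(2) by (simp add: dot_square_norm)
  also have "\<dots> = (\<Sum>b\<in>Basis. (b \<bullet> F x)\<^sup>2)"
    using euclidean_inner[of "F x" "F x"] by (simp add: power2_eq_square inner_commute)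
  also have "\<dots> \<le> (\<Sum>b\<in>Basis. (b \<bullet> F b) * (x \<bullet> F x))"
    by (intro sum_mono psd_Cauchy_Schwarz assms)
  also have "\<dots> = tr F * (x \<bullet> F x)" by (simp add: tr_def sum_distrib_right)
  finally show ?thesis using pos by (simp add: power2_eq_square)
qed

lemma has_vector_derivative_funpow_pencil:
  fixes E Q :: "'e::euclidean_space \<Rightarrow> 'e"
  assumes "linear E" "linear Q"
  defines "D \<equiv> \<lambda>s x. E x + s *\<^sub>R Q x"
  shows "((\<lambda>s. (D s ^^ k) y) has_vector_derivative
           (\<Sum>j<k. (D s ^^ j) (Q ((D s ^^ (k - 1 - j)) y)))) (at s)"
proof (induction k)
  case (Suc k)
  let ?y' = "\<Sum>j<k. (D s ^^ j) (Q ((D s ^^ (k - 1 - j)) y))"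
  have lin: "linear (D s)"
    unfolding D_def using assms(1,2) by (intro linear_compose_add linear_compose_scale_right)
  have 1: "((\<lambda>s. E ((D s ^^ k) y)) has_vector_derivative E ?y') (at s)"
    using bounded_linear.has_vector_derivative[OF _ Suc, of E] assms(1)
    by (simp add: linear_conv_bounded_linear)
  have 2: "((\<lambda>s. Q ((D s ^^ k) y)) has_vector_derivative Q ?y') (at s)"
    using bounded_linear.has_vector_derivative[OF _ Suc, of Q] assms(2)
    by (simp add: linear_conv_bounded_linear)
  have "((\<lambda>s. E ((D s ^^ k) y) + s *\<^sub>R Q ((D s ^^ k) y)) has_vector_derivative
      E ?y' + (s *\<^sub>R Q ?y' + 1 *\<^sub>R Q ((D s ^^ k) y))) (at s)"
    by (intro has_vector_derivative_add 1 has_vector_derivative_scaleR 2 DERIV_ident)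
  also have "E ?y' + (s *\<^sub>R Q ?y' + 1 *\<^sub>R Q ((D s ^^ k) y)) = Q ((D s ^^ k) y) + D s ?y'"
    by (simp add: D_def)
  also have "\<dots> = (\<Sum>j<Suc k. (D s ^^ j) (Q ((D s ^^ (Suc k - 1 - j)) y)))"
    by (simp add: sum.lessThan_Suc_shift linear_sum[OF lin] del: sum.lessThan_Suc)
  finally show ?case by (simp add: D_def)
qed simp

definition rank_one :: "'e::euclidean_space \<Rightarrow> 'e \<Rightarrow> 'e" where
  "rank_one v x = (v \<bullet> x) *\<^sub>R v"

lemma linear_rank_one: "linear (rank_one v)"
  by (auto simp: rank_one_def linear_iff inner_add_right scaleR_add_left)

lemma selfadjoint_rank_one: "selfadjoint (rank_one v)"
  by (auto simp: selfadjoint_def linear_rank_one) (simp add: rank_one_def inner_commute)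

lemma psd_rank_one: "psd (rank_one v)"
  by (auto simp: psd_def selfadjoint_rank_one) (simp add: rank_one_def inner_commute)

lemma selfadjoint_lincomb:
  assumes "selfadjoint E" "selfadjoint F"
  shows "selfadjoint (\<lambda>x. a *\<^sub>R E x + b *\<^sub>R F x)"
  using assms unfolding selfadjoint_def
  by (auto intro!: linear_compose_add linear_compose_scale_right simp: inner_add_left inner_add_right)

lemma selfadjoint_id: "selfadjoint (\<lambda>x. x)"
  by (simp add: selfadjoint_def linear_id[unfolded id_def])

lemma psd_ident: "psd (\<lambda>x. x)"
  by (simp add: psd_def selfadjoint_id)

lemma psd_add_scaled:
  assumes "psd E" "psd F" "0 \<le> t"
  shows "psd (\<lambda>x. E x + t *\<^sub>R F x)"
  using assms selfadjoint_lincomb[of E F 1 t] unfolding psd_def by (auto simp: inner_add_right)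

definition orth_proj :: "'e::euclidean_space \<Rightarrow> 'e \<Rightarrow> 'e" where
  "orth_proj v x = x - (v \<bullet> x) *\<^sub>R v"

lemma psd_orth_proj:
  assumes "norm v = 1" shows "psd (orth_proj v)"
proof -
  have "orth_proj v = (\<lambda>x. 1 *\<^sub>R x + (-1) *\<^sub>R rank_one v x)"
    by (auto simp: orth_proj_def rank_one_def)
  moreover have "0 \<le> x \<bullet> orth_proj v x" for x
  proof -
    have "\<bar>v \<bullet> x\<bar> \<le> norm x" using Cauchy_Schwarz_ineq2[of v x] assms by simp
    then have "(v \<bullet> x)\<^sup>2 \<le> (norm x)\<^sup>2" by (metis abs_le_square_iff abs_norm_cancel)
    then show ?thesis
      by (simp add: orth_proj_def inner_diff_right inner_commute power2_eq_square
          flip: dot_square_norm[unfolded power2_eq_square])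
  qed
  ultimately show ?thesis
    using selfadjoint_lincomb[OF selfadjoint_id selfadjoint_rank_one, of 1 "-1" v]
    by (simp add: psd_def)
qed

text \<open>
  Moving mass orthogonally to \<open>v\<close> can only increase the moments at \<open>v\<close>.  With
  \<open>D = E + s Q\<close> and \<open>Q\<close> the projection along \<open>v\<close>, the derivative of \<open>v \<bullet> D\<^sup>k v\<close> is the sum of
  \<open>v \<bullet> D\<^sup>j Q D\<^sup>i v = h (i + j) - h i * h j\<close> over \<open>i + j = k - 1\<close>, where \<open>h\<close> are the moments of \<open>D\<close>, and
  every such term is nonnegative by \<open>psd_moment_mult_le\<close>.
\<close>
lemma moment_mono_orth_proj:
  assumes v: "norm v = 1" and E: "selfadjoint E"
    and psd: "psd (\<lambda>x. E x + a *\<^sub>R orth_proj v x)" and ab: "a \<le> b"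
  shows "v \<bullet> ((\<lambda>x. E x + a *\<^sub>R orth_proj v x) ^^ k) v \<le> v \<bullet> ((\<lambda>x. E x + b *\<^sub>R orth_proj v x) ^^ k) v"
proof -
  define D where "D = (\<lambda>s x. E x + s *\<^sub>R orth_proj v x)"
  have psdD: "psd (D s)" if "a \<le> s" for s
  proof -
    have "D s = (\<lambda>x. (E x + a *\<^sub>R orth_proj v x) + (s - a) *\<^sub>R orth_proj v x)"
      by (auto simp: D_def algebra_simps)
    then show ?thesis
      using psd_add_scaled[OF psd psd_orth_proj[OF v], of "s - a"] that by simp
  qed
  have lin: "linear E" "linear (orth_proj v)"
    using E psd_orth_proj[OF v] by (auto simp: psd_def selfadjoint_def)
  let ?f = "\<lambda>s. v \<bullet> (D s ^^ k) v"
  have "\<exists>y. (?f has_real_derivative y) (at s) \<and> 0 \<le> y" if "a \<le> s" "s \<le> b" for s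
  proof (intro exI conjI)
    let ?d = "\<Sum>j<k. v \<bullet> (D s ^^ j) (orth_proj v ((D s ^^ (k - 1 - j)) v))"
    have "((\<lambda>s. v \<bullet> (D s ^^ k) v) has_vector_derivative ?d) (at s)"
      unfolding inner_sum_right[symmetric]
      using bounded_linear.has_vector_derivative[OF bounded_linear_inner_right
          has_vector_derivative_funpow_pencil[OF lin, of k v s]] by (simp add: D_def)
    then show "(?f has_real_derivative ?d) (at s)"
      by (simp add: has_real_derivative_iff_has_vector_derivative)
    show "0 \<le> ?d"
    proof (intro sum_nonneg)
      fix j assume "j \<in> {..<k}"
      have sa: "selfadjoint (D s)" using psdD[OF \<open>a \<le> s\<close>] by (simp add: psd_def)
      let ?i = "k - 1 - j"
      have "v \<bullet> (D s ^^ j) (orth_proj v ((D s ^^ ?i) v))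
          = v \<bullet> (D s ^^ (j + ?i)) v - (v \<bullet> (D s ^^ j) v) * (v \<bullet> (D s ^^ ?i) v)"
        unfolding moment_add[OF sa] selfadjoint_funpow[OF sa, of j v, symmetric] orth_proj_def
        by (simp add: inner_diff_right inner_commute)
      also have "\<dots> \<ge> 0" using psd_moment_mult_le[OF psdD[OF \<open>a \<le> s\<close>] v] by simp
      finally show "0 \<le> v \<bullet> (D s ^^ j) (orth_proj v ((D s ^^ ?i) v))" .
    qed
  qed
  then show ?thesis using DERIV_nonneg_imp_nondecreasing[OF ab, of ?f] by (simp add: D_def)
qed

text \<open>
  A polynomial counterpart of the Golden-Thompson inequality for a rank-one summand.  For
  \<open>N\<close> large and operators \<open>1 + H / N\<close> the powers approach exponentials, and the statement
  becomes \<open>tr (exp (H + s v v\<^sup>T)) \<le> tr (exp H) + (exp s - 1) * (v \<bullet> exp H v)\<close>.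

  Both sides agree at \<open>\<epsilon> = 0\<close>.  Their derivatives in \<open>\<epsilon>\<close> are \<open>N\<close> times the \<open>(N - 1)\<close>-st moments at \<open>v\<close>
  of \<open>C + \<epsilon> v v\<^sup>T\<close> and of \<open>C + \<epsilon>\<close>.  These two operators differ by \<open>\<epsilon>\<close> times the
  projection along \<open>v\<close>, so \<open>moment_mono_orth_proj\<close> orders the derivatives, in one direction
  for positive and in the other for negative \<open>\<epsilon>\<close>.  Both signs are needed, for
  the upper and for the lower tail.
\<close>
lemma tr_power_rank_one_update:
  assumes v: "norm v = 1" and C: "psd C" and C\<epsilon>: "psd (\<lambda>x. C x + \<epsilon> *\<^sub>R x)"
  shows "tr ((\<lambda>x. C x + \<epsilon> *\<^sub>R rank_one v x) ^^ N)
      \<le> tr (C ^^ N) + (v \<bullet> ((\<lambda>x. C x + \<epsilon> *\<^sub>R x) ^^ N) v - v \<bullet> (C ^^ N) v)"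
proof -
  have sa: "selfadjoint C" and lin: "linear C" using C by (auto simp: psd_def selfadjoint_def)
  define D where "D = (\<lambda>t x. C x + t *\<^sub>R rank_one v x)"
  define S where "S = (\<lambda>t x. C x + t *\<^sub>R x)"
  have saD: "selfadjoint (D t)" for t
    using selfadjoint_lincomb[OF sa selfadjoint_rank_one, of 1 t v] by (simp add: D_def)
  have saS: "selfadjoint (S t)" for t
    using selfadjoint_lincomb[OF sa selfadjoint_id, of 1 t] by (simp add: S_def)
  have derD: "((\<lambda>t. tr (D t ^^ N)) has_real_derivative N * (v \<bullet> (D t ^^ (N - 1)) v)) (at t)" for t
  proof -
    let ?d = "\<Sum>b\<in>Basis. \<Sum>j<N. b \<bullet> (D t ^^ j) (rank_one v ((D t ^^ (N - 1 - j)) b))"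
    have "((\<lambda>t. \<Sum>b\<in>Basis. b \<bullet> (D t ^^ N) b) has_vector_derivative ?d) (at t)"
      unfolding inner_sum_right[symmetric] D_def
      by (intro has_vector_derivative_sum
          bounded_linear.has_vector_derivative[OF bounded_linear_inner_right]
          has_vector_derivative_funpow_pencil lin linear_rank_one)
    also have "?d = (\<Sum>j<N. \<Sum>b\<in>Basis. ((D t ^^ j) v \<bullet> b) * ((D t ^^ (N - 1 - j)) v \<bullet> b))"
    proof (subst sum.swap, intro sum.cong refl)
      fix j b
      have "linear (D t ^^ j)" using linear_funpow saD by (auto simp: selfadjoint_def)
      then show "b \<bullet> (D t ^^ j) (rank_one v ((D t ^^ (N - 1 - j)) b))
          = ((D t ^^ j) v \<bullet> b) * ((D t ^^ (N - 1 - j)) v \<bullet> b)"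
        by (simp add: rank_one_def linear_scale inner_commute[of b]
            selfadjoint_funpow[OF saD, where x = v])
    qed
    also have "\<dots> = (\<Sum>j<N. v \<bullet> (D t ^^ (j + (N - 1 - j))) v)"
      by (simp only: moment_add[OF saD] euclidean_inner[symmetric])
    also have "\<dots> = N * (v \<bullet> (D t ^^ (N - 1)) v)"
      by simp
    finally show ?thesis
      by (simp add: has_real_derivative_iff_has_vector_derivative tr_def)
  qed
  have derS: "((\<lambda>t. v \<bullet> (S t ^^ N) v) has_real_derivative N * (v \<bullet> (S t ^^ (N - 1)) v)) (at t)" for t
  proof -
    let ?d = "\<Sum>j<N. v \<bullet> (S t ^^ j) ((S t ^^ (N - 1 - j)) v)"
    have "((\<lambda>t. v \<bullet> (S t ^^ N) v) has_vector_derivative ?d) (at t)"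
      unfolding inner_sum_right[symmetric] S_def
      by (intro bounded_linear.has_vector_derivative[OF bounded_linear_inner_right]
          has_vector_derivative_funpow_pencil lin linear_ident)
    also have "?d = (\<Sum>j<N. v \<bullet> (S t ^^ (j + (N - 1 - j))) v)"
      by (simp only: funpow_add o_apply)
    also have "\<dots> = N * (v \<bullet> (S t ^^ (N - 1)) v)" by simp
    finally show ?thesis by (simp add: has_real_derivative_iff_has_vector_derivative)
  qed
  let ?f = "\<lambda>t. v \<bullet> (S t ^^ N) v - tr (D t ^^ N)"
  have der: "(?f has_real_derivative N * (v \<bullet> (S t ^^ (N - 1)) v - v \<bullet> (D t ^^ (N - 1)) v)) (at t)" for t
    using DERIV_diff[OF derS derD, of t] by (simp add: algebra_simps)
  have D_eq: "D t = (\<lambda>x. S t x + (- t) *\<^sub>R orth_proj v x)" for t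
    by (auto simp: D_def S_def orth_proj_def rank_one_def algebra_simps)
  have "?f 0 \<le> ?f \<epsilon>"
  proof (cases "0 \<le> \<epsilon>")
    case True
    show ?thesis
    proof (rule DERIV_nonneg_imp_nondecreasing[OF True], intro exI conjI, rule der)
      fix t :: real assume t: "0 \<le> t" "t \<le> \<epsilon>"
      have "psd (D t)" using psd_add_scaled[OF C psd_rank_one t(1)] by (simp add: D_def)
      then have "v \<bullet> (D t ^^ (N - 1)) v \<le> v \<bullet> (S t ^^ (N - 1)) v"
        using moment_mono_orth_proj[OF v saS[of t], of "- t" 0 "N - 1"] t by (simp add: D_eq)
      then show "0 \<le> N * (v \<bullet> (S t ^^ (N - 1)) v - v \<bullet> (D t ^^ (N - 1)) v)" by simp
    qed
  next
    case False
    then have "\<epsilon> \<le> 0" by simp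
    show ?thesis
    proof (rule DERIV_nonpos_imp_nonincreasing[OF \<open>\<epsilon> \<le> 0\<close>], intro exI conjI, rule der)
      fix t :: real assume t: "\<epsilon> \<le> t" "t \<le> 0"
      have "S t = (\<lambda>x. (C x + \<epsilon> *\<^sub>R x) + (t - \<epsilon>) *\<^sub>R x)"
        by (auto simp: S_def algebra_simps)
      then have "psd (S t)" using psd_add_scaled[OF C\<epsilon> psd_ident, of "t - \<epsilon>"] t by simp
      then have "v \<bullet> (S t ^^ (N - 1)) v \<le> v \<bullet> (D t ^^ (N - 1)) v"
        using moment_mono_orth_proj[OF v saS[of t], of 0 "- t" "N - 1"] t by (simp add: D_eq)
      then show "N * (v \<bullet> (S t ^^ (N - 1)) v - v \<bullet> (D t ^^ (N - 1)) v) \<le> 0"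
        by (simp add: mult_nonneg_nonpos)
    qed
  qed
  then show ?thesis by (simp add: D_def S_def)
qed

section \<open>A matrix Chernoff bound for isotropic unit vectors\<close>

text \<open>
  The operator \<open>a + \<epsilon> \<Sum>\<^sub>i v\<^sub>i v\<^sub>i\<^sup>T\<close> with \<open>v\<^sub>i = V (x i)\<close>.  The scalar part \<open>a\<close> is kept as a parameter
  because averaging over one of the \<open>v\<^sub>i\<close> shifts it.
\<close>
definition frame_pencil :: "real \<Rightarrow> real \<Rightarrow> ('a \<Rightarrow> 'e::euclidean_space) \<Rightarrow> 'i set \<Rightarrow> ('i \<Rightarrow> 'a) \<Rightarrow> 'e \<Rightarrow> 'e" where
  "frame_pencil a \<epsilon> V I x z = a *\<^sub>R z + \<epsilon> *\<^sub>R (\<Sum>i\<in>I. rank_one (V (x i)) z)"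

lemma inner_frame_pencil:
  "z \<bullet> frame_pencil a \<epsilon> V I x z = a * (z \<bullet> z) + \<epsilon> * (\<Sum>i\<in>I. (V (x i) \<bullet> z)\<^sup>2)"
  by (simp add: frame_pencil_def rank_one_def inner_add_right inner_sum_right inner_commute
      power2_eq_square)

lemma selfadjoint_frame_pencil: "selfadjoint (frame_pencil a \<epsilon> V I x)"
proof -
  have "selfadjoint (\<lambda>z. \<Sum>i\<in>I. rank_one (V (x i)) z)"
    using selfadjoint_rank_one unfolding selfadjoint_def
    by (auto intro!: linear_compose_sum simp: inner_sum_left inner_sum_right)
  from selfadjoint_lincomb[OF selfadjoint_id this, of a \<epsilon>] show ?thesis
    by (simp add: frame_pencil_def[abs_def])
qed

lemma psd_frame_pencil:
  fixes a \<epsilon> :: real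
  assumes V: "\<And>y. norm (V y) \<le> 1" and a: "0 \<le> a" "0 \<le> a + \<epsilon> * card I"
  shows "psd (frame_pencil a \<epsilon> V I x)"
  unfolding psd_def
proof (intro conjI allI selfadjoint_frame_pencil)
  fix z :: 'b
  have "(V y \<bullet> z)\<^sup>2 \<le> z \<bullet> z" for y
  proof -
    have "(V y \<bullet> z)\<^sup>2 \<le> (V y \<bullet> V y) * (z \<bullet> z)" by (rule Cauchy_Schwarz_ineq)
    also have "\<dots> \<le> 1 * (z \<bullet> z)"
      using V[of y] by (intro mult_right_mono) (auto simp: dot_square_norm power_le_one)
    finally show ?thesis by simp
  qed
  then have le: "(\<Sum>i\<in>I. (V (x i) \<bullet> z)\<^sup>2) \<le> card I * (z \<bullet> z)"
    using sum_bounded_above[of I "\<lambda>i. (V (x i) \<bullet> z)\<^sup>2" "z \<bullet> z"] by simp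
  show "0 \<le> z \<bullet> frame_pencil a \<epsilon> V I x z"
  proof (cases "0 \<le> \<epsilon>")
    case True
    then show ?thesis using a by (simp add: inner_frame_pencil sum_nonneg)
  next
    case False
    have "0 \<le> (a + \<epsilon> * card I) * (z \<bullet> z)" using a by simp
    also have "\<dots> = a * (z \<bullet> z) + \<epsilon> * (card I * (z \<bullet> z))" by (simp add: algebra_simps)
    also have "\<dots> \<le> z \<bullet> frame_pencil a \<epsilon> V I x z"
      unfolding inner_frame_pencil using False le by (intro add_left_mono mult_left_mono_neg) auto
    finally show ?thesis .
  qed
qed

lemma frame_pencil_insert:
  assumes "finite I" "i \<notin> I"
  shows "frame_pencil a \<epsilon> V (insert i I) (x(i := y))
    = (\<lambda>z. frame_pencil a \<epsilon> V I x z + \<epsilon> *\<^sub>R rank_one (V y) z)"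
proof -
  have "(\<Sum>j\<in>I. rank_one (V ((x(i := y)) j)) z) = (\<Sum>j\<in>I. rank_one (V (x j)) z)" for z
    using assms by (intro sum.cong) auto
  then show ?thesis using assms by (auto simp: frame_pencil_def[abs_def] algebra_simps)
qed

lemma frame_pencil_shift:
  "(\<lambda>z. frame_pencil a \<epsilon> V I x z + t *\<^sub>R z) = frame_pencil (a + t) \<epsilon> V I x"
  by (auto simp: frame_pencil_def algebra_simps)

lemma measurable_frame_pencil_power:
  fixes V :: "'a \<Rightarrow> 'e::euclidean_space"
  assumes [measurable]: "V \<in> borel_measurable R"
  shows "(\<lambda>x. (frame_pencil a \<epsilon> V I x ^^ k) z) \<in> borel_measurable (PiM I (\<lambda>_. R))"
proof (induction k)
  case (Suc k)
  have V: "(\<lambda>x. V (x i)) \<in> borel_measurable (PiM I (\<lambda>_. R))" if "i \<in> I" for i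
    using that by measurable
  have "(\<lambda>x. frame_pencil a \<epsilon> V I x ((frame_pencil a \<epsilon> V I x ^^ k) z)) \<in> borel_measurable (PiM I (\<lambda>_. R))"
    unfolding frame_pencil_def[of _ _ _ _ _ "(_ ^^ _) _"] rank_one_def
    by (intro borel_measurable_add borel_measurable_scaleR borel_measurable_const
        borel_measurable_sum borel_measurable_inner V Suc)
  then show ?case by simp
qed simp

lemma measurable_tr_frame_pencil_power:
  fixes V :: "'a \<Rightarrow> 'e::euclidean_space"
  assumes "V \<in> borel_measurable R"
  shows "(\<lambda>x. tr (frame_pencil a \<epsilon> V I x ^^ k)) \<in> borel_measurable (PiM I (\<lambda>_. R))"
  unfolding tr_def
  by (intro borel_measurable_sum borel_measurable_inner measurable_frame_pencil_power assms) auto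

lemma one_add_exp_div_nonneg:
  fixes m t :: real
  assumes "1 \<le> m" shows "0 \<le> 1 + (exp t - 1) / m"
proof -
  have "1 + (exp t - 1) / m = (m - 1 + exp t) / m" using assms by (simp add: field_simps)
  moreover have "0 \<le> m - 1 + exp t" using assms exp_gt_zero[of t] by linarith
  ultimately show ?thesis using assms by simp
qed

lemma quadratic_form_expand:
  fixes F :: "'e::euclidean_space \<Rightarrow> 'e"
  assumes "linear F"
  shows "v \<bullet> F v = (\<Sum>b\<in>Basis. \<Sum>b'\<in>Basis. (v \<bullet> b) * (v \<bullet> b') * (b \<bullet> F b'))"
proof -
  have Fv: "F v = (\<Sum>b'\<in>Basis. (v \<bullet> b') *\<^sub>R F b')"
    using euclidean_representation[of v] linear_sum[OF assms] linear_scale[OF assms]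
    by (metis (no_types, lifting) sum.cong)
  have "F v \<bullet> b = (\<Sum>b'\<in>Basis. (v \<bullet> b') * (b \<bullet> F b'))" for b
    unfolding Fv inner_sum_left by (simp add: inner_commute[of b])
  then show ?thesis by (simp add: euclidean_inner[of v "F v"] sum_distrib_left mult.assoc)
qed

text \<open>
  Isotropy means \<open>E (V V\<^sup>T) = 1 / dim\<close>.  The bound on \<open>V\<close> at every point keeps the frame operators
  positive everywhere, not just almost everywhere.
\<close>
locale isotropic_unit_vector = prob_space R for R :: "'a measure" +
  fixes V :: "'a \<Rightarrow> 'e::euclidean_space"
  assumes V_meas[measurable]: "V \<in> borel_measurable R"
    and V_le: "\<And>y. norm (V y) \<le> 1"
    and V_unit: "AE y in R. norm (V y) = 1"
    and V_iso: "\<And>b b'. b \<in> Basis \<Longrightarrow> b' \<in> Basis \<Longrightarrow>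
      (\<integral>y. (V y \<bullet> b) * (V y \<bullet> b') \<partial>R) = (if b = b' then 1 / DIM('e) else 0)"
begin

lemma integrable_coord_prod: "b \<in> Basis \<Longrightarrow> b' \<in> Basis \<Longrightarrow> integrable R (\<lambda>y. (V y \<bullet> b) * (V y \<bullet> b'))"
proof (rule integrable_const_bound[of _ 1])
  assume b: "b \<in> Basis" "b' \<in> Basis"
  have "\<bar>V y \<bullet> b\<bar> \<le> 1" if "b \<in> Basis" for y b
    using Basis_le_norm[OF that, of "V y"] V_le[of y] by simp
  from mult_mono[OF this[OF b(1)] this[OF b(2)]] show "AE y in R. norm ((V y \<bullet> b) * (V y \<bullet> b')) \<le> 1"
    by (simp add: abs_mult)
qed simp

lemma integrable_quadratic_form:
  fixes F :: "'e \<Rightarrow> 'e"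
  assumes "linear F" shows "integrable R (\<lambda>y. V y \<bullet> F (V y))"
  unfolding quadratic_form_expand[OF assms]
  by (intro Bochner_Integration.integrable_sum integrable_mult_left integrable_coord_prod)

lemma integral_quadratic_form:
  fixes F :: "'e \<Rightarrow> 'e"
  assumes "linear F"
  shows "(\<integral>y. V y \<bullet> F (V y) \<partial>R) = tr F / DIM('e)"
proof -
  have "(\<integral>y. V y \<bullet> F (V y) \<partial>R)
      = (\<Sum>b\<in>Basis. \<Sum>b'\<in>Basis. (\<integral>y. (V y \<bullet> b) * (V y \<bullet> b') \<partial>R) * (b \<bullet> F b'))"
    unfolding quadratic_form_expand[OF assms]
    by (simp add: Bochner_Integration.integral_sum Bochner_Integration.integrable_sum integrable_mult_left
        integrable_coord_prod del: inner_Basis)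
  also have "\<dots> = (\<Sum>b\<in>Basis. \<Sum>b'\<in>Basis. (if b = b' then 1 / DIM('e) else 0) * (b \<bullet> F b'))"
    by (intro sum.cong refl) (simp add: V_iso)
  also have "\<dots> = tr F / DIM('e)"
    by (simp add: tr_def sum_divide_distrib if_distrib[of "\<lambda>c. c * _"] cong: if_cong)
  finally show ?thesis .
qed

text \<open>
  Averaging the rank-one inequality over \<open>V\<close> turns both moments into normalized traces: in
  expectation, adding \<open>\<epsilon> V V\<^sup>T\<close> is no worse than adding \<open>\<epsilon>\<close> to the whole operator with
  probability \<open>1 / dim\<close> and leaving it unchanged otherwise.
\<close>
lemma nn_integral_tr_power_update:
  fixes C :: "'e \<Rightarrow> 'e"
  assumes C: "psd C" and C\<epsilon>: "psd (\<lambda>x. C x + \<epsilon> *\<^sub>R x)"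
  shows "(\<integral>\<^sup>+y. ennreal (tr ((\<lambda>x. C x + \<epsilon> *\<^sub>R rank_one (V y) x) ^^ N)) \<partial>R)
    \<le> ennreal ((1 - 1 / DIM('e)) * tr (C ^^ N) + 1 / DIM('e) * tr ((\<lambda>x. C x + \<epsilon> *\<^sub>R x) ^^ N))"
proof -
  let ?S = "\<lambda>x. C x + \<epsilon> *\<^sub>R x"
  have lin: "linear (C ^^ N)" "linear (?S ^^ N)"
    using C C\<epsilon> by (auto intro!: linear_funpow simp: psd_def selfadjoint_def)
  let ?f = "\<lambda>y. tr (C ^^ N) + (V y \<bullet> (?S ^^ N) (V y) - V y \<bullet> (C ^^ N) (V y))"
  have int: "integrable R ?f"
    by (intro integrable_const Bochner_Integration.integrable_add Bochner_Integration.integrable_diff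
        integrable_quadratic_form lin)
  have le_tr: "V y \<bullet> (C ^^ N) (V y) \<le> tr (C ^^ N)" if "norm (V y) = 1" for y
    by (rule quadratic_form_le_tr[OF psd_funpow[OF C] that])
  from V_unit have nonneg: "AE y in R. 0 \<le> ?f y"
  proof (elim eventually_mono)
    fix y assume "norm (V y) = 1"
    from le_tr[OF this] show "0 \<le> ?f y"
      using psd_moment_nonneg[OF C\<epsilon>, of "V y" N] by simp
  qed
  have "(\<integral>\<^sup>+y. ennreal (tr ((\<lambda>x. C x + \<epsilon> *\<^sub>R rank_one (V y) x) ^^ N)) \<partial>R) \<le> (\<integral>\<^sup>+y. ennreal (?f y) \<partial>R)"
    using V_unit by (intro nn_integral_mono_AE)
      (auto elim!: eventually_mono intro!: ennreal_leI tr_power_rank_one_update C C\<epsilon>)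
  also have "\<dots> = ennreal (\<integral>y. ?f y \<partial>R)" by (rule nn_integral_eq_integral[OF int nonneg])
  also have "(\<integral>y. ?f y \<partial>R) = tr (C ^^ N) + (tr (?S ^^ N) / DIM('e) - tr (C ^^ N) / DIM('e))"
    by (simp add: integrable_quadratic_form lin integral_quadratic_form prob_space)
  also have "\<dots> = (1 - 1 / DIM('e)) * tr (C ^^ N) + 1 / DIM('e) * tr (?S ^^ N)"
    by (simp add: algebra_simps)
  finally show ?thesis .
qed

text \<open>
  Iterating the previous bound compares the trace with the scalar model in which \<open>\<epsilon>\<close> is
  added a binomial number of times.  Since \<open>a ^ N \<le> exp (N * (a - 1))\<close>, the moment generating
  function of the binomial distribution appears on the right, without any limit in \<open>N\<close>.
\<close>
lemma nn_integral_tr_frame_pencil_power: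
  fixes a \<epsilon> :: real
  assumes "finite I" "0 \<le> a" "0 \<le> a + \<epsilon> * card I"
  shows "(\<integral>\<^sup>+x. ennreal (tr (frame_pencil a \<epsilon> V I x ^^ N)) \<partial>PiM I (\<lambda>_. R))
    \<le> ennreal (DIM('e) * exp (N * (a - 1)) * (1 + (exp (N * \<epsilon>) - 1) / DIM('e)) ^ card I)"
  using assms
proof (induction I arbitrary: a rule: finite_induct)
  case empty
  interpret E: prob_space "PiM {} (\<lambda>_. R)" by (rule prob_space_PiM) (rule prob_space_axioms)
  have pow: "(frame_pencil a \<epsilon> V {} x ^^ N) z = a ^ N *\<^sub>R z" for x z
    by (induction N) (simp_all add: frame_pencil_def)
  have "a ^ N \<le> exp (N * (a - 1))"
    using power_mono[of a "exp (a - 1)" N] exp_ge_add_one_self[of "a - 1"] empty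
    by (simp flip: exp_of_nat_mult)
  then show ?case by (simp add: tr_def pow E.emeasure_space_1 ennreal_leI)
next
  case (insert i I)
  interpret product_sigma_finite "\<lambda>_. R" ..
  interpret P: prob_space "PiM I (\<lambda>_. R)" by (rule prob_space_PiM) (rule prob_space_axioms)
  let ?m = "real DIM('e)" and ?F = "\<lambda>a x. frame_pencil a \<epsilon> V I x" and ?q = "1 + (exp (N * \<epsilon>) - 1) / DIM('e)"
  have m: "1 \<le> ?m" by (simp add: Suc_leI)
  have card: "card (insert i I) = Suc (card I)" using insert by simp
  have a\<epsilon>: "0 \<le> a + \<epsilon>" "0 \<le> a + \<epsilon> * card I" "0 \<le> (a + \<epsilon>) + \<epsilon> * card I"
  proof -
    have *: "0 \<le> a + \<epsilon> * (1 + card I)" using insert.prems card by simp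
    then show "0 \<le> (a + \<epsilon>) + \<epsilon> * card I" by (simp add: algebra_simps)
    show "0 \<le> a + \<epsilon>" "0 \<le> a + \<epsilon> * card I"
    proof (atomize(full), cases "0 \<le> \<epsilon>")
      case False
      then have "\<epsilon> * (1 + card I) \<le> \<epsilon> * 1" "\<epsilon> * (1 + card I) \<le> \<epsilon> * card I"
        by (intro mult_left_mono_neg; simp)+
      then show "0 \<le> a + \<epsilon> \<and> 0 \<le> a + \<epsilon> * card I" using * by linarith
    qed (use insert.prems in auto)
  qed
  have psd: "psd (?F a x) \<and> psd (?F (a + \<epsilon>) x)" for x
  proof
    show "psd (?F a x)" using a\<epsilon> insert.prems by (intro psd_frame_pencil[OF V_le])
    show "psd (?F (a + \<epsilon>) x)" using a\<epsilon> by (intro psd_frame_pencil[OF V_le])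
  qed
  note [measurable] = measurable_tr_frame_pencil_power[OF V_meas]
  have "(\<integral>\<^sup>+x. ennreal (tr (frame_pencil a \<epsilon> V (insert i I) x ^^ N)) \<partial>PiM (insert i I) (\<lambda>_. R))
      = (\<integral>\<^sup>+x. (\<integral>\<^sup>+y. ennreal (tr (frame_pencil a \<epsilon> V (insert i I) (x(i := y)) ^^ N)) \<partial>R) \<partial>PiM I (\<lambda>_. R))"
    using insert by (intro product_nn_integral_insert) auto
  also have "\<dots> \<le> (\<integral>\<^sup>+x. ennreal ((1 - 1 / ?m) * tr (?F a x ^^ N) + 1 / ?m * tr (?F (a + \<epsilon>) x ^^ N)) \<partial>PiM I (\<lambda>_. R))"
    unfolding frame_pencil_insert[OF insert.hyps(1,2)]
    using nn_integral_tr_power_update[of "?F a _" \<epsilon> N] psd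
    by (intro nn_integral_mono) (simp add: frame_pencil_shift)
  also have "\<dots> = (\<integral>\<^sup>+x. ennreal (1 - 1 / ?m) * ennreal (tr (?F a x ^^ N))
      + ennreal (1 / ?m) * ennreal (tr (?F (a + \<epsilon>) x ^^ N)) \<partial>PiM I (\<lambda>_. R))"
    using m by (intro nn_integral_cong) (simp add: ennreal_plus ennreal_mult tr_funpow_nonneg psd
        divide_le_eq flip: ennreal_mult ennreal_plus)
  also have "\<dots> = ennreal (1 - 1 / ?m) * (\<integral>\<^sup>+x. ennreal (tr (?F a x ^^ N)) \<partial>PiM I (\<lambda>_. R))
      + ennreal (1 / ?m) * (\<integral>\<^sup>+x. ennreal (tr (?F (a + \<epsilon>) x ^^ N)) \<partial>PiM I (\<lambda>_. R))"
    by (simp add: nn_integral_add nn_integral_cmult)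
  also have "\<dots> \<le> ennreal (1 - 1 / ?m) * ennreal (?m * exp (N * (a - 1)) * ?q ^ card I)
      + ennreal (1 / ?m) * ennreal (?m * exp (N * (a + \<epsilon> - 1)) * ?q ^ card I)"
    using a\<epsilon> insert.prems by (intro add_mono mult_left_mono insert.IH) auto
  also have "\<dots> = ennreal ((1 - 1 / ?m) * (?m * exp (N * (a - 1)) * ?q ^ card I)
      + 1 / ?m * (?m * exp (N * (a + \<epsilon> - 1)) * ?q ^ card I))"
  proof -
    have "0 \<le> ?q" using m by (rule one_add_exp_div_nonneg)
    then show ?thesis using m by (simp add: divide_le_eq flip: ennreal_mult ennreal_plus)
  qed
  also have "(1 - 1 / ?m) * (?m * exp (N * (a - 1)) * ?q ^ card I)
      + 1 / ?m * (?m * exp (N * (a + \<epsilon> - 1)) * ?q ^ card I)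
      = ?m * exp (N * (a - 1)) * ?q ^ card I * (1 - 1 / ?m + 1 / ?m * exp (N * \<epsilon>))"
  proof -
    have "exp (N * (a + \<epsilon> - 1)) = exp (N * (a - 1)) * exp (N * \<epsilon>)"
      by (simp add: algebra_simps flip: exp_add)
    then show ?thesis by (simp only: distrib_left distrib_right ac_simps)
  qed
  also have "1 - 1 / ?m + 1 / ?m * exp (N * \<epsilon>) = ?q" by (simp add: diff_divide_distrib)
  finally show ?case by (simp add: card ac_simps)
qed


text \<open>
  Markov's inequality for the trace of the \<open>N\<close>-th power, which dominates the \<open>N\<close>-th power of every
  value of the quadratic form on the unit sphere.
\<close>
lemma tail_bound_fixed_power:
  fixes \<theta> y :: real
  assumes I: "finite I" and N: "0 < N" "\<bar>\<theta>\<bar> * card I \<le> N" "0 \<le> 1 + y / N"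
    and sub: "A \<subseteq> {x \<in> space (PiM I (\<lambda>_. R)). \<exists>z. norm z = 1 \<and> y \<le> \<theta> * (\<Sum>i\<in>I. (V (x i) \<bullet> z)\<^sup>2)}"
  shows "measure (PiM I (\<lambda>_. R)) A * (1 + y / N) ^ N \<le> DIM('e) * (1 + (exp \<theta> - 1) / DIM('e)) ^ card I"
proof -
  interpret P: prob_space "PiM I (\<lambda>_. R)" by (rule prob_space_PiM) (rule prob_space_axioms)
  let ?P = "PiM I (\<lambda>_. R)" and ?F = "frame_pencil 1 (\<theta> / N) V I" and ?c = "(1 + y / N) ^ N"
  let ?b = "DIM('e) * (1 + (exp \<theta> - 1) / DIM('e)) ^ card I"
  note [measurable] = measurable_tr_frame_pencil_power[OF V_meas]
  have b0: "0 \<le> ?b"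
  proof -
    have "1 \<le> real DIM('e)" by (simp add: Suc_leI)
    then have "0 \<le> 1 + (exp \<theta> - 1) / DIM('e)" by (rule one_add_exp_div_nonneg)
    then show ?thesis by simp
  qed
  have "- 1 \<le> \<theta> / N * card I"
  proof -
    have "- (\<bar>\<theta>\<bar> * card I) \<le> \<theta> * card I"
      using mult_right_mono[of "- \<bar>\<theta>\<bar>" \<theta> "card I"] by simp
    then have "- real N \<le> \<theta> * card I" using N by linarith
    then show ?thesis using N by (simp add: field_simps)
  qed
  then have psd: "psd (?F x)" for x by (intro psd_frame_pencil V_le) auto
  have "A \<subseteq> {x \<in> space ?P. ?c \<le> tr (?F x ^^ N)}"
  proof
    fix x assume "x \<in> A"
    then obtain z where x: "x \<in> space ?P" and z: "norm z = 1"
      and y: "y \<le> \<theta> * (\<Sum>i\<in>I. (V (x i) \<bullet> z)\<^sup>2)" using sub by auto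
    have "1 + y / N \<le> z \<bullet> ?F x z"
      using y z N by (simp add: inner_frame_pencil dot_square_norm divide_right_mono)
    then have "?c \<le> (z \<bullet> ?F x z) ^ N" using N by (intro power_mono)
    also have "\<dots> \<le> z \<bullet> (?F x ^^ N) z" by (rule psd_moment_power_le[OF psd z])
    also have "\<dots> \<le> tr (?F x ^^ N)" by (rule quadratic_form_le_tr[OF psd_funpow[OF psd] z])
    finally show "x \<in> {x \<in> space ?P. ?c \<le> tr (?F x ^^ N)}" using x by simp
  qed
  then have "measure ?P A * ?c \<le> measure ?P {x \<in> space ?P. ?c \<le> tr (?F x ^^ N)} * ?c"
    using N by (intro mult_right_mono P.finite_measure_mono) auto
  also have "ennreal \<dots> \<le> ennreal ?b"
  proof -
    have "ennreal (measure ?P {x \<in> space ?P. ?c \<le> tr (?F x ^^ N)} * ?c)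
       = (\<integral>\<^sup>+x. ennreal ?c * indicator {x \<in> space ?P. ?c \<le> tr (?F x ^^ N)} x \<partial>?P)"
      using N by (simp add: nn_integral_cmult_indicator P.emeasure_eq_measure ennreal_mult mult.commute)
    also have "\<dots> \<le> (\<integral>\<^sup>+x. ennreal (tr (?F x ^^ N)) \<partial>?P)"
      by (intro nn_integral_mono) (auto simp: indicator_def ennreal_leI)
    also have "\<dots> \<le> ennreal ?b"
      using nn_integral_tr_frame_pencil_power[OF I, of 1 "\<theta> / N" N] N \<open>- 1 \<le> \<theta> / N * card I\<close> by simp
    finally show ?thesis .
  qed
  then have "measure ?P {x \<in> space ?P. ?c \<le> tr (?F x ^^ N)} * ?c \<le> ?b"
    using b0 by (simp add: ennreal_le_iff)
  finally show ?thesis .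
qed

text \<open>
  The Chernoff bound for one side of the spectrum: let \<open>N\<close> tend to infinity in the previous
  bound.  A positive \<open>\<theta>\<close> controls the largest and a negative \<open>\<theta>\<close> the smallest eigenvalue.
\<close>
lemma tail_bound:
  fixes \<theta> y :: real
  assumes I: "finite I"
    and sub: "A \<subseteq> {x \<in> space (PiM I (\<lambda>_. R)). \<exists>z. norm z = 1 \<and> y \<le> \<theta> * (\<Sum>i\<in>I. (V (x i) \<bullet> z)\<^sup>2)}"
  shows "measure (PiM I (\<lambda>_. R)) A \<le> DIM('e) * exp (card I * (exp \<theta> - 1) / DIM('e) - y)"
proof -
  let ?p = "measure (PiM I (\<lambda>_. R)) A" and ?m = "real DIM('e)"
  let ?q = "1 + (exp \<theta> - 1) / ?m"
  have "?p * exp y \<le> ?m * ?q ^ card I"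
  proof (rule tendsto_upperbound)
    show "(\<lambda>N. ?p * (1 + y / real N) ^ N) \<longlonglongrightarrow> ?p * exp y"
      by (intro tendsto_mult tendsto_const tendsto_exp_limit_sequentially)
    obtain N0 :: nat where N0: "\<bar>\<theta>\<bar> * card I + \<bar>y\<bar> \<le> N0" using real_arch_simple by blast
    show "\<forall>\<^sub>F N in sequentially. ?p * (1 + y / real N) ^ N \<le> ?m * ?q ^ card I"
      using eventually_gt_at_top[of "N0"]
    proof eventually_elim
      case (elim N)
      then have "\<bar>\<theta>\<bar> * card I + \<bar>y\<bar> \<le> N" "0 < N" using N0 by auto
      moreover have "0 \<le> \<bar>\<theta>\<bar> * card I" by simp
      ultimately have "\<bar>\<theta>\<bar> * card I \<le> N" "0 \<le> y + N" "0 < N"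
        by linarith+
      then have "\<bar>\<theta>\<bar> * card I \<le> N" "0 \<le> 1 + y / N" "0 < N"
        by (auto simp: field_simps)
      then show ?case using tail_bound_fixed_power[OF I _ _ _ sub] by blast
    qed
  qed simp
  also have "\<dots> \<le> ?m * exp ((exp \<theta> - 1) / ?m) ^ card I"
  proof -
    have "1 \<le> ?m" by (simp add: Suc_leI)
    then have "0 \<le> ?q" by (rule one_add_exp_div_nonneg)
    then show ?thesis by (intro mult_left_mono power_mono exp_ge_add_one_self) auto
  qed
  also have "\<dots> = ?m * exp (card I * (exp \<theta> - 1) / ?m)" by (simp flip: exp_of_nat_mult)
  finally have "?p \<le> ?m * exp (card I * (exp \<theta> - 1) / ?m) / exp y"
    by (simp add: pos_le_divide_eq)
  then show ?thesis by (simp add: exp_diff)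
qed

end

text \<open>
  The difference of the two rates has the derivative \<open>- ln (1 - \<delta>\<^sup>2) \<ge> 0\<close>; so the rate of the upper
  tail serves for both tails of the spectrum.
\<close>
lemma upper_rate_le_lower_rate:
  fixes \<delta> :: real
  assumes "0 \<le> \<delta>" "\<delta> < 1"
  shows "- \<delta> + (1 + \<delta>) * ln (1 + \<delta>) \<le> \<delta> + (1 - \<delta>) * ln (1 - \<delta>)"
proof -
  let ?f = "\<lambda>t::real. 2 * t + (1 - t) * ln (1 - t) - (1 + t) * ln (1 + t)"
  have "?f 0 \<le> ?f \<delta>"
  proof (rule DERIV_nonneg_imp_nondecreasing[OF assms(1)], intro exI conjI)
    fix t :: real assume t: "0 \<le> t" "t \<le> \<delta>"
    have "(?f has_real_derivative 2 + (- ln (1 - t) - (1 - t) * (1 / (1 - t)))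
        - (ln (1 + t) + (1 + t) * (1 / (1 + t)))) (at t)"
      using t assms by (auto intro!: derivative_eq_intros)
    then show "(?f has_real_derivative - (ln (1 - t) + ln (1 + t))) (at t)"
      using t assms by simp
    have "ln (1 - t) + ln (1 + t) = ln ((1 - t) * (1 + t))" using t assms by (simp add: ln_mult)
    also have "\<dots> \<le> 0"
    proof -
      have "t * t \<le> t * 1" using t assms by (intro mult_left_mono) auto
      then have "0 < (1 - t) * (1 + t)" "(1 - t) * (1 + t) \<le> 1"
        using t assms by (auto simp: algebra_simps)
      then show ?thesis by simp
    qed
    finally show "0 \<le> - (ln (1 - t) + ln (1 + t))" by simp
  qed
  then show ?thesis by (simp add: algebra_simps)
qed

text \<open>
  An uncountable supremum of measurable functions that depend continuously on the index is
  measurable, since a countable dense set of indices suffices.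
\<close>
lemma sets_ex_less_continuous:
  fixes q :: "'x \<Rightarrow> 'e::euclidean_space \<Rightarrow> real"
  assumes meas: "\<And>z. (\<lambda>x. q x z) \<in> borel_measurable M"
    and cont: "\<And>x. continuous_on UNIV (q x)"
  shows "{x \<in> space M. \<exists>z\<in>S. c < q x z} \<in> sets M"
proof -
  obtain T where T: "countable T" "T \<subseteq> S" "S \<subseteq> closure T" using separable by blast
  have "(\<exists>z\<in>S. c < q x z) \<longleftrightarrow> (\<exists>z\<in>T. c < q x z)" for x
  proof
    assume "\<exists>z\<in>S. c < q x z"
    then obtain z where z: "z \<in> closure T" "c < q x z" using T by auto
    have "open {w. c < q x w}" using cont by (intro open_Collect_less) auto
    with z have "{w. c < q x w} \<inter> T \<noteq> {}" using open_Int_closure_eq_empty by blast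
    then show "\<exists>z\<in>T. c < q x z" by auto
  qed (use T in auto)
  then have "{x \<in> space M. \<exists>z\<in>S. c < q x z} = (\<Union>z\<in>T. {x \<in> space M. c < q x z})" by auto
  also have "\<dots> \<in> sets M"
    using T meas by (intro sets.countable_UN') auto
  finally show ?thesis .
qed

context isotropic_unit_vector begin

text \<open>
  The optimal exponents in the two tail bounds are \<open>\<theta> = ln (1 + \<delta>)\<close> and \<open>\<theta> = ln (1 - \<delta>)\<close>.
\<close>
lemma deviation_bound:
  assumes I: "finite I" "I \<noteq> {}" and \<delta>: "0 < \<delta>" "\<delta> < 1"
    and sub: "A \<subseteq> {x \<in> space (PiM I (\<lambda>_. R)).
        \<exists>z. norm z = 1 \<and> \<delta> < \<bar>DIM('e) / card I * (\<Sum>i\<in>I. (V (x i) \<bullet> z)\<^sup>2) - 1\<bar>}"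
  shows "measure (PiM I (\<lambda>_. R)) A \<le> 2 * DIM('e) * exp (- (card I / DIM('e)) * (- \<delta> + (1 + \<delta>) * ln (1 + \<delta>)))"
proof -
  interpret P: prob_space "PiM I (\<lambda>_. R)" by (rule prob_space_PiM) (rule prob_space_axioms)
  let ?P = "PiM I (\<lambda>_. R)" and ?m = "real DIM('e)" and ?n = "real (card I)"
  let ?S = "\<lambda>x z. \<Sum>i\<in>I. (V (x i) \<bullet> z)\<^sup>2"
  define A1 where "A1 = {x \<in> space ?P. \<exists>z\<in>{z. norm z = 1}. 1 + \<delta> < ?m / ?n * ?S x z}"
  define A2 where "A2 = {x \<in> space ?P. \<exists>z\<in>{z. norm z = 1}. \<delta> - 1 < - (?m / ?n) * ?S x z}"
  have n: "0 < ?n" using I by (simp add: card_gt_0_iff)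
  have m: "0 < ?m" by simp
  have S: "(\<lambda>x. ?S x z) \<in> borel_measurable ?P" for z
    by measurable
  have cS: "continuous_on UNIV (?S x)" for x
    by (intro continuous_intros)
  have A12: "A1 \<in> sets ?P" "A2 \<in> sets ?P"
    unfolding A1_def A2_def
    by (intro sets_ex_less_continuous borel_measurable_times borel_measurable_const S
        continuous_on_mult continuous_on_const cS)+
  have ex: "?n * \<delta> / ?m - ?n / ?m * (1 + \<delta>) * ln (1 + \<delta>) = - (?n / ?m) * (- \<delta> + (1 + \<delta>) * ln (1 + \<delta>))"
    by (simp add: field_simps)
  have "measure ?P A1 \<le> ?m * exp (?n * (exp (ln (1 + \<delta>)) - 1) / ?m - ?n / ?m * (1 + \<delta>) * ln (1 + \<delta>))"
  proof (rule tail_bound[OF I(1)], unfold A1_def, safe)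
    fix x z assume "1 + \<delta> < ?m / ?n * ?S x z" and z: "norm (z::'e) = 1"
    then have "?n / ?m * (1 + \<delta>) \<le> ?S x z" using n m by (simp add: field_simps)
    then have "ln (1 + \<delta>) * (?n / ?m * (1 + \<delta>)) \<le> ln (1 + \<delta>) * ?S x z" using \<delta> by (intro mult_left_mono) auto
    then show "\<exists>z. norm z = 1 \<and> ?n / ?m * (1 + \<delta>) * ln (1 + \<delta>) \<le> ln (1 + \<delta>) * ?S x z"
      using z by (intro exI[of _ z]) (simp add: ac_simps)
  qed
  then have 1: "measure ?P A1 \<le> ?m * exp (- (?n / ?m) * (- \<delta> + (1 + \<delta>) * ln (1 + \<delta>)))"
    using \<delta> ex by simp
  have "measure ?P A2 \<le> ?m * exp (?n * (exp (ln (1 - \<delta>)) - 1) / ?m - ?n / ?m * (1 - \<delta>) * ln (1 - \<delta>))"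
  proof (rule tail_bound[OF I(1)], unfold A2_def, safe)
    fix x z assume "\<delta> - 1 < - (?m / ?n) * ?S x z" and z: "norm (z::'e) = 1"
    then have "?m / ?n * ?S x z < 1 - \<delta>" by simp
    then have "?S x z \<le> ?n / ?m * (1 - \<delta>)" using n m by (simp add: field_simps)
    then have "ln (1 - \<delta>) * (?n / ?m * (1 - \<delta>)) \<le> ln (1 - \<delta>) * ?S x z" using \<delta> by (intro mult_left_mono_neg) auto
    then show "\<exists>z. norm z = 1 \<and> ?n / ?m * (1 - \<delta>) * ln (1 - \<delta>) \<le> ln (1 - \<delta>) * ?S x z"
      using z by (intro exI[of _ z]) (simp add: ac_simps)
  qed
  also have "?n * (exp (ln (1 - \<delta>)) - 1) / ?m - ?n / ?m * (1 - \<delta>) * ln (1 - \<delta>)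
      = - (?n / ?m) * (\<delta> + (1 - \<delta>) * ln (1 - \<delta>))" using \<delta> by (simp add: field_simps)
  also have "?m * exp (- (?n / ?m) * (\<delta> + (1 - \<delta>) * ln (1 - \<delta>)))
     \<le> ?m * exp (- (?n / ?m) * (- \<delta> + (1 + \<delta>) * ln (1 + \<delta>)))"
    using upper_rate_le_lower_rate[of \<delta>] \<delta> n m
    by (intro mult_left_mono) (auto intro!: divide_right_mono mult_left_mono)
  finally have 2: "measure ?P A2 \<le> ?m * exp (- (?n / ?m) * (- \<delta> + (1 + \<delta>) * ln (1 + \<delta>)))" .
  have "A \<subseteq> A1 \<union> A2"
  proof
    fix x assume "x \<in> A"
    then obtain z where z: "x \<in> space ?P" "norm (z::'e) = 1" "\<delta> < \<bar>?m / ?n * ?S x z - 1\<bar>"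
      using sub by blast
    then consider "1 + \<delta> < ?m / ?n * ?S x z" | "?m / ?n * ?S x z < 1 - \<delta>" by linarith
    then show "x \<in> A1 \<union> A2" using z by cases (force simp: A1_def A2_def)+
  qed
  then have "measure ?P A \<le> measure ?P (A1 \<union> A2)" using A12 by (intro P.finite_measure_mono) auto
  also have "\<dots> \<le> measure ?P A1 + measure ?P A2" using A12 by (intro measure_Un_le) auto
  finally show ?thesis using 1 2 by simp
qed

end

section \<open>Gram matrices of weighted samples\<close>

locale orthonormal_system = prob_space \<mu> for \<mu> :: "'a measure" +
  fixes \<phi> :: "'m::finite \<Rightarrow> 'a \<Rightarrow> real"
  assumes orthonormal: "L2_orthonormal \<mu> \<phi>"
begin

lemma phi_measurable[measurable]: "\<phi> j \<in> borel_measurable \<mu>"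
  using orthonormal by (auto simp: L2_orthonormal_def L2_space_def)

lemma phi_square_integrable: "integrable \<mu> (\<lambda>x. (\<phi> j x)\<^sup>2)"
  using orthonormal by (auto simp: L2_orthonormal_def L2_space_def)

lemma integral_phi_mult: "(\<integral>x. \<phi> j x * \<phi> k x \<partial>\<mu>) = (if j = k then 1 else 0)"
  using orthonormal by (auto simp: L2_orthonormal_def L2_inner_def)

lemma weight_measurable[measurable]: "weight \<phi> \<in> borel_measurable \<mu>"
  unfolding weight_def[abs_def] by measurable

end

lemma inverse_weight: "inverse (weight \<phi> x) = (\<Sum>j\<in>UNIV. (\<phi> j x)\<^sup>2) / real CARD('m)"
  for \<phi> :: "'m::finite \<Rightarrow> 'a \<Rightarrow> real"
  by (simp add: weight_def)

lemma weight_nonneg: "0 \<le> weight \<phi> x"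
  by (simp add: weight_def sum_nonneg)

lemma weight_eq_0_iff: "weight \<phi> x = 0 \<longleftrightarrow> (\<forall>j. \<phi> j x = 0)"
  by (auto simp: weight_def sum_nonneg_eq_0_iff)

text \<open>
  The scaling by the weight makes this a unit vector wherever some \<open>\<phi> j\<close> does not vanish,
  and the Gram matrix of a sample a multiple of a sum of rank-one projections.
\<close>
definition feature :: "('m::finite \<Rightarrow> 'a \<Rightarrow> real) \<Rightarrow> 'a \<Rightarrow> real^'m" where
  "feature \<phi> x = sqrt (weight \<phi> x / CARD('m)) *\<^sub>R (\<chi> j. \<phi> j x)"

lemma norm_feature:
  fixes \<phi> :: "'m::finite \<Rightarrow> 'a \<Rightarrow> real"
  shows "norm (feature \<phi> x) = (if weight \<phi> x = 0 then 0 else 1)"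
proof -
  have "(norm (feature \<phi> x))\<^sup>2 = weight \<phi> x * inverse (weight \<phi> x)"
    by (simp add: feature_def inverse_weight weight_nonneg power_mult_distrib norm_vec_def L2_set_def
        sum_nonneg sum_distrib_left sum_divide_distrib)
  then show ?thesis
    by (cases "weight \<phi> x = 0") (auto simp: power2_eq_1_iff, smt (verit) norm_ge_zero)
qed

lemma rank_one_feature:
  fixes \<phi> :: "'m::finite \<Rightarrow> 'a \<Rightarrow> real"
  shows "weight \<phi> x *\<^sub>R ((\<chi> j k. \<phi> j x * \<phi> k x) *v z) = real CARD('m) *\<^sub>R rank_one (feature \<phi> x) z"
  using weight_nonneg[of \<phi> x]
  by (simp add: vec_eq_iff feature_def rank_one_def matrix_vector_mult_def inner_vec_def
      sum_distrib_left sum_distrib_right ac_simps flip: real_sqrt_mult power2_eq_square)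

lemma gram_mult_vec:
  fixes \<phi> :: "'m::finite \<Rightarrow> 'a \<Rightarrow> real"
  shows "gram \<phi> x I *v z = (real CARD('m) / card I) *\<^sub>R (\<Sum>i\<in>I. rank_one (feature \<phi> (x i)) z)"
proof -
  have sum: "(\<Sum>i\<in>I. A i) *v z = (\<Sum>i\<in>I. A i *v z)" for A :: "nat \<Rightarrow> real^'m^'m"
    by (induction I rule: infinite_finite_induct) (auto simp: matrix_vector_mult_add_rdistrib)
  show ?thesis
    unfolding gram_def scaleR_matrix_vector_assoc[symmetric] sum rank_one_feature
    by (simp flip: scaleR_sum_right)
qed

lemma inner_gram:
  fixes \<phi> :: "'m::finite \<Rightarrow> 'a \<Rightarrow> real"
  shows "z \<bullet> (gram \<phi> x I *v z) = real CARD('m) / card I * (\<Sum>i\<in>I. (feature \<phi> (x i) \<bullet> z)\<^sup>2)"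
  by (simp add: gram_mult_vec rank_one_def inner_sum_right inner_commute power2_eq_square)

text \<open>
  The operator norm of a self-adjoint operator is the supremum of its quadratic form on the
  unit sphere: polarize \<open>y \<bullet> F x\<close> for \<open>y\<close> the multiple of \<open>F x\<close> that has the length of \<open>x\<close>.
\<close>
lemma onorm_selfadjoint_le:
  fixes F :: "'e::euclidean_space \<Rightarrow> 'e"
  assumes F: "selfadjoint F" and c: "\<And>z. norm z = 1 \<Longrightarrow> \<bar>z \<bullet> F z\<bar> \<le> c" and "0 \<le> c"
  shows "onorm F \<le> c"
proof (rule onorm_bound[OF \<open>0 \<le> c\<close>])
  have lin: "linear F" and sym: "F x \<bullet> y = x \<bullet> F y" for x y
    using F by (auto simp: selfadjoint_def)
  have q: "\<bar>z \<bullet> F z\<bar> \<le> c * (norm z)\<^sup>2" for z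
  proof (cases "z = 0")
    case False
    then have "\<bar>(z /\<^sub>R norm z) \<bullet> F (z /\<^sub>R norm z)\<bar> \<le> c" by (intro c) simp
    then show ?thesis using False by (simp add: linear_scale[OF lin] field_simps power2_eq_square abs_mult)
  qed (simp add: linear_0[OF lin])
  fix x
  show "norm (F x) \<le> c * norm x"
  proof (cases "F x = 0 \<or> x = 0")
    case False
    define s where "s = norm x / norm (F x)"
    define y where "y = s *\<^sub>R F x"
    have s: "0 < s" using False by (simp add: s_def)
    have ny: "norm y = norm x" using False by (simp add: y_def s_def)
    have "4 * (y \<bullet> F x) = (x + y) \<bullet> F (x + y) - (x - y) \<bullet> F (x - y)"
      by (simp add: linear_add[OF lin] linear_diff[OF lin] inner_simps sym[of x y, symmetric] inner_commute[of _ y])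
    also have "\<dots> \<le> c * (norm (x + y))\<^sup>2 + c * (norm (x - y))\<^sup>2"
      using q[of "x + y"] q[of "x - y"] by linarith
    also have "\<dots> = 4 * (c * (norm x)\<^sup>2)"
    proof -
      have "(norm (x + y))\<^sup>2 + (norm (x - y))\<^sup>2 = 2 * (norm x)\<^sup>2 + 2 * (norm y)\<^sup>2"
        by (simp add: power2_norm_eq_inner inner_simps inner_commute)
      then show ?thesis unfolding ny by (simp flip: distrib_left)
    qed
    finally have "y \<bullet> F x \<le> c * (norm x)\<^sup>2" by simp
    also have "y \<bullet> F x = norm x * norm (F x)"
      using False by (simp add: y_def s_def dot_square_norm power2_eq_square)
    finally show ?thesis using False by (simp add: power2_eq_square)
  qed (auto simp: linear_0[OF lin] \<open>0 \<le> c\<close>)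
qed

lemma abs_inner_le_onorm:
  fixes F :: "'e::euclidean_space \<Rightarrow> 'e"
  assumes "linear F"
  shows "\<bar>z \<bullet> F z\<bar> \<le> onorm F * (z \<bullet> z)"
proof -
  have "\<bar>z \<bullet> F z\<bar> \<le> norm z * norm (F z)" by (rule Cauchy_Schwarz_ineq2)
  also have "\<dots> \<le> norm z * (onorm F * norm z)"
    using assms by (intro mult_left_mono onorm) (auto simp: linear_conv_bounded_linear)
  finally show ?thesis by (simp add: dot_square_norm power2_eq_square ac_simps)
qed

lemma selfadjoint_gram_diff: "selfadjoint ((*v) (gram \<phi> x I - mat 1))"
proof -
  have *: "(gram \<phi> x I - mat 1) *v z = gram \<phi> x I *v z - z" for z
    by (simp add: matrix_vector_mult_diff_rdistrib)
  have "(gram \<phi> x I *v y) \<bullet> z = y \<bullet> (gram \<phi> x I *v z)" for y z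
    unfolding gram_mult_vec
    by (simp add: inner_sum_left inner_sum_right selfadjoint_rank_one[unfolded selfadjoint_def])
  then show ?thesis
    by (auto simp: selfadjoint_def matrix_vector_mul_linear *  inner_diff_left inner_diff_right)
qed

lemma inner_gram_diff:
  fixes \<phi> :: "'m::finite \<Rightarrow> 'a \<Rightarrow> real"
  shows "z \<bullet> ((gram \<phi> x I - mat 1) *v z)
    = real CARD('m) / card I * (\<Sum>i\<in>I. (feature \<phi> (x i) \<bullet> z)\<^sup>2) - z \<bullet> z"
  by (simp add: matrix_vector_mult_diff_rdistrib inner_diff_right inner_gram)

lemma Zdev_nonneg: "0 \<le> Zdev \<phi> x I"
  unfolding Zdev_def by (rule onorm_pos_le) (simp add: matrix_vector_mul_bounded_linear)

lemma less_Zdev_iff: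
  fixes \<phi> :: "'m::finite \<Rightarrow> 'a \<Rightarrow> real"
  assumes "0 \<le> c"
  shows "c < Zdev \<phi> x I \<longleftrightarrow>
    (\<exists>z. norm z = 1 \<and> c < \<bar>CARD('m) / card I * (\<Sum>i\<in>I. (feature \<phi> (x i) \<bullet> z)\<^sup>2) - 1\<bar>)"
proof
  assume less: "c < Zdev \<phi> x I"
  have "\<exists>z. norm z = 1 \<and> c < \<bar>z \<bullet> ((gram \<phi> x I - mat 1) *v z)\<bar>"
  proof (rule ccontr)
    assume "\<nexists>z. norm z = 1 \<and> c < \<bar>z \<bullet> ((gram \<phi> x I - mat 1) *v z)\<bar>"
    then have "Zdev \<phi> x I \<le> c"
      unfolding Zdev_def
      by (intro onorm_selfadjoint_le selfadjoint_gram_diff assms) (auto simp: not_less)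
    then show False using less by simp
  qed
  then show "\<exists>z. norm z = 1 \<and> c < \<bar>CARD('m) / card I * (\<Sum>i\<in>I. (feature \<phi> (x i) \<bullet> z)\<^sup>2) - 1\<bar>"
    by (simp add: inner_gram_diff dot_square_norm cong: conj_cong)
next
  assume "\<exists>z. norm z = 1 \<and> c < \<bar>CARD('m) / card I * (\<Sum>i\<in>I. (feature \<phi> (x i) \<bullet> z)\<^sup>2) - 1\<bar>"
  then obtain z where "norm z = 1" "c < \<bar>z \<bullet> ((gram \<phi> x I - mat 1) *v z)\<bar>"
    by (auto simp: inner_gram_diff dot_square_norm)
  then show "c < Zdev \<phi> x I"
    using abs_inner_le_onorm[OF matrix_vector_mul_linear, of z "gram \<phi> x I - mat 1"]
    by (simp add: Zdev_def dot_square_norm)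
qed

lemma inner_gram_ge:
  assumes "Zdev \<phi> x I \<le> \<delta>"
  shows "(1 - \<delta>) * (z \<bullet> z) \<le> z \<bullet> (gram \<phi> x I *v z)"
proof -
  have "\<bar>z \<bullet> ((gram \<phi> x I - mat 1) *v z)\<bar> \<le> Zdev \<phi> x I * (z \<bullet> z)"
    unfolding Zdev_def by (rule abs_inner_le_onorm[OF matrix_vector_mul_linear])
  also have "\<dots> \<le> \<delta> * (z \<bullet> z)" using assms by (intro mult_right_mono) auto
  finally show ?thesis by (simp add: matrix_vector_mult_diff_rdistrib inner_diff_right algebra_simps abs_le_iff)
qed

context orthonormal_system begin

lemma nn_integral_rho:
  assumes [measurable]: "f \<in> borel_measurable \<mu>"
  shows "(\<integral>\<^sup>+x. f x \<partial>rho \<mu> \<phi>) = (\<integral>\<^sup>+x. ennreal (inverse (weight \<phi> x)) * f x \<partial>\<mu>)"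
  unfolding rho_def by (subst nn_integral_density) auto

lemma integral_rho:
  fixes f :: "'a \<Rightarrow> real"
  assumes [measurable]: "f \<in> borel_measurable \<mu>"
  shows "(\<integral>x. f x \<partial>rho \<mu> \<phi>) = (\<integral>x. inverse (weight \<phi> x) * f x \<partial>\<mu>)"
  unfolding rho_def by (subst integral_density) (auto simp: weight_nonneg)

lemma sets_rho[simp, measurable_cong]: "sets (rho \<mu> \<phi>) = sets \<mu>" and space_rho[simp]: "space (rho \<mu> \<phi>) = space \<mu>"
  by (auto simp: rho_def)

lemma integral_inverse_weight: "(\<integral>x. inverse (weight \<phi> x) \<partial>\<mu>) = 1"
  unfolding inverse_weight using phi_square_integrable integral_phi_mult
  by (simp add: power2_eq_square)

lemma integrable_inverse_weight: "integrable \<mu> (\<lambda>x. inverse (weight \<phi> x))"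
  unfolding inverse_weight using phi_square_integrable by simp

lemma prob_space_rho: "prob_space (rho \<mu> \<phi>)"
proof
  have "emeasure (rho \<mu> \<phi>) (space (rho \<mu> \<phi>)) = (\<integral>\<^sup>+x. 1 \<partial>rho \<mu> \<phi>)" by simp
  also have "\<dots> = (\<integral>\<^sup>+x. ennreal (inverse (weight \<phi> x)) \<partial>\<mu>)" by (subst nn_integral_rho) auto
  also have "\<dots> = ennreal (\<integral>x. inverse (weight \<phi> x) \<partial>\<mu>)"
    using integrable_inverse_weight by (intro nn_integral_eq_integral) (auto simp: weight_nonneg)
  also have "(\<integral>x. inverse (weight \<phi> x) \<partial>\<mu>) = 1" by (rule integral_inverse_weight)
  finally show "emeasure (rho \<mu> \<phi>) (space (rho \<mu> \<phi>)) = 1" by simp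
qed

lemma feature_measurable[measurable]: "feature \<phi> \<in> borel_measurable \<mu>"
proof (subst borel_measurable_euclidean_space, intro ballI)
  fix b :: "real^'m" assume "b \<in> Basis"
  then obtain j where "b = axis j 1" by (auto simp: Basis_vec_def)
  then show "(\<lambda>x. feature \<phi> x \<bullet> b) \<in> borel_measurable \<mu>"
    by (simp add: feature_def inner_axis)
qed

text \<open>
  The density of \<open>rho \<mu> \<phi>\<close> cancels the weight, so isotropy of the feature vector under \<open>rho \<mu> \<phi>\<close> is the
  orthonormality of \<open>\<phi>\<close>.
\<close>
sublocale sampled: isotropic_unit_vector "rho \<mu> \<phi>" "feature \<phi>"
proof (intro isotropic_unit_vector.intro isotropic_unit_vector_axioms.intro prob_space_rho)
  show "feature \<phi> \<in> borel_measurable (rho \<mu> \<phi>)" by measurable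
  show "norm (feature \<phi> y) \<le> 1" for y by (simp add: norm_feature)
  show "AE y in rho \<mu> \<phi>. norm (feature \<phi> y) = 1"
    unfolding rho_def by (subst AE_density) (auto simp: norm_feature)
  fix b b' :: "real^'m" assume "b \<in> Basis" "b' \<in> Basis"
  then obtain j k where bb: "b = axis j 1" "b' = axis k 1" by (auto simp: Basis_vec_def)
  have "inverse (weight \<phi> y) * ((feature \<phi> y \<bullet> b) * (feature \<phi> y \<bullet> b')) = \<phi> j y * \<phi> k y / real CARD('m)" for y
  proof (cases "weight \<phi> y = 0")
    case True
    then show ?thesis by (simp add: weight_eq_0_iff)
  next
    case False
    have "(feature \<phi> y \<bullet> b) * (feature \<phi> y \<bullet> b') = (sqrt (weight \<phi> y / real CARD('m)))\<^sup>2 * (\<phi> j y * \<phi> k y)"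
      by (simp add: bb feature_def inner_axis power2_eq_square del: real_sqrt_mult_self)
    then show ?thesis using False weight_nonneg[of \<phi> y] by (simp add: field_simps)
  qed
  then show "(\<integral>y. (feature \<phi> y \<bullet> b) * (feature \<phi> y \<bullet> b') \<partial>rho \<mu> \<phi>)
      = (if b = b' then 1 / DIM(real^'m) else 0)"
    by (subst integral_rho) (auto simp: integral_phi_mult bb axis_eq_axis)
qed

lemma Zdev_measurable[measurable]:
  "(\<lambda>x. Zdev \<phi> x I) \<in> borel_measurable (PiM I (\<lambda>_. rho \<mu> \<phi>))"
proof (subst borel_measurable_iff_greater, intro allI)
  fix c :: real
  let ?P = "PiM I (\<lambda>_. rho \<mu> \<phi>)"
  show "{x \<in> space ?P. c < Zdev \<phi> x I} \<in> sets ?P"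
  proof (cases "0 \<le> c")
    case False
    then have "c < Zdev \<phi> x I" for x using Zdev_nonneg[of \<phi> x I] by linarith
    then have "{x \<in> space ?P. c < Zdev \<phi> x I} = space ?P" by auto
    then show ?thesis by simp
  next
    case True
    have "{x \<in> space ?P. \<exists>z\<in>{z. norm z = 1}. c < \<bar>real CARD('m) / card I * (\<Sum>i\<in>I. (feature \<phi> (x i) \<bullet> z)\<^sup>2) - 1\<bar>} \<in> sets ?P"
      by (intro sets_ex_less_continuous continuous_intros) measurable
    then show ?thesis using less_Zdev_iff[OF True, of \<phi> _ I] by (simp add: Bex_def)
  qed
qed

text \<open>
  The sample size condition is what makes the Chernoff bound \<open>2 * m * exp (- n * d\<^sub>\<delta> / m)\<close> at most \<open>\<eta>\<close>.
\<close>
lemma prob_Zdev_gt_le: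
  assumes \<delta>: "0 < \<delta>" "\<delta> < 1" and \<eta>: "0 < \<eta>" "\<eta> < 1" and n: "n_bound \<delta> \<eta> CARD('m) \<le> real n"
    and "0 < n"
  shows "measure (rho_n \<mu> \<phi> n) {x \<in> space (rho_n \<mu> \<phi> n). \<delta> < Zdev \<phi> x {1..n}} \<le> \<eta>"
proof -
  have d: "0 < d_const \<delta>"
  proof -
    have "\<exists>z>0. z < \<delta> \<and> ((1 + \<delta>) * ln (1 + \<delta>) - \<delta>) - ((1 + 0) * ln (1 + 0) - 0) = (\<delta> - 0) * ln (1 + z)"
    proof (rule MVT2[OF \<delta>(1)])
      fix t :: real assume "0 \<le> t"
      then show "((\<lambda>t. (1 + t) * ln (1 + t) - t) has_real_derivative ln (1 + t)) (at t)"
        by (auto intro!: derivative_eq_intros)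
    qed
    then obtain z where z: "0 < z" and "(1 + \<delta>) * ln (1 + \<delta>) - \<delta> = \<delta> * ln (1 + z)" by auto
    moreover have "0 < \<delta> * ln (1 + z)" using z \<delta> by (intro mult_pos_pos ln_gt_zero) auto
    ultimately show ?thesis by (simp add: d_const_def)
  qed
  have "measure (rho_n \<mu> \<phi> n) {x \<in> space (rho_n \<mu> \<phi> n). \<delta> < Zdev \<phi> x {1..n}}
      \<le> 2 * real CARD('m) * exp (- (n / real CARD('m)) * d_const \<delta>)"
    using sampled.deviation_bound[of "{1..n}" \<delta> "{x \<in> space (rho_n \<mu> \<phi> n). \<delta> < Zdev \<phi> x {1..n}}"] \<delta> \<open>0 < n\<close>
    by (simp add: rho_n_def less_Zdev_iff d_const_def subset_eq)
  also have "\<dots> \<le> 2 * real CARD('m) * exp (- ln (2 * real CARD('m) * inverse \<eta>))"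
  proof -
    have "ln (2 * real CARD('m) * inverse \<eta>) \<le> n / real CARD('m) * d_const \<delta>"
      using n d by (simp add: n_bound_def field_simps)
    then show ?thesis by (intro mult_left_mono) auto
  qed
  also have "\<dots> = \<eta>" using \<eta> by (simp add: exp_minus field_simps)
  finally show ?thesis .
qed

end

section \<open>Weighted least squares and greedy subsampling\<close>

definition lincomb :: "('m::finite \<Rightarrow> 'a \<Rightarrow> real) \<Rightarrow> real^'m \<Rightarrow> 'a \<Rightarrow> real" where
  "lincomb \<phi> c x = (\<Sum>j\<in>UNIV. c $ j * \<phi> j x)"

lemma basis_span_eq_range_lincomb: "basis_span \<phi> = range (lincomb \<phi>)"
proof
  show "range (lincomb \<phi>) \<subseteq> basis_span \<phi>" by (auto simp: basis_span_def lincomb_def[abs_def])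
  show "basis_span \<phi> \<subseteq> range (lincomb \<phi>)"
  proof
    fix v assume "v \<in> basis_span \<phi>"
    then obtain c where "v = (\<lambda>x. \<Sum>j\<in>UNIV. c j * \<phi> j x)" by (auto simp: basis_span_def)
    then have "v = lincomb \<phi> (\<chi> j. c j)" by (simp add: lincomb_def[abs_def])
    then show "v \<in> range (lincomb \<phi>)" by blast
  qed
qed

lemma weighted_lincomb:
  fixes \<phi> :: "'m::finite \<Rightarrow> 'a \<Rightarrow> real"
  shows "sqrt (weight \<phi> x) * lincomb \<phi> c x = sqrt (CARD('m)) * (feature \<phi> x \<bullet> c)"
  by (simp add: lincomb_def feature_def inner_vec_def sum_distrib_left real_sqrt_divide ac_simps)

lemma emp_norm_square:
  "(emp_norm \<phi> x I v)\<^sup>2 = 1 / real (card I) * (\<Sum>i\<in>I. (sqrt (weight \<phi> (x i)) * v (x i))\<^sup>2)"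
  by (simp add: emp_norm_def weight_nonneg sum_nonneg power_mult_distrib)

text \<open>
  The empirical error is a quadratic polynomial in the coefficients whose Hessian is given by
  the Gram matrix; \<open>b\<close> collects the empirical inner products of \<open>u\<close> with the basis.
\<close>
lemma emp_norm_square_diff_lincomb:
  fixes \<phi> :: "'m::finite \<Rightarrow> 'a \<Rightarrow> real" and u :: "'a \<Rightarrow> real"
  defines "b \<equiv> \<lambda>x I. (sqrt (CARD('m)) / card I) *\<^sub>R (\<Sum>i\<in>I. (sqrt (weight \<phi> (x i)) * u (x i)) *\<^sub>R feature \<phi> (x i))"
  shows "(emp_norm \<phi> x I (\<lambda>t. u t - lincomb \<phi> c t))\<^sup>2
    = (emp_norm \<phi> x I u)\<^sup>2 - 2 * (c \<bullet> b x I) + c \<bullet> (gram \<phi> x I *v c)"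
proof -
  let ?w = "\<lambda>i. sqrt (weight \<phi> (x i))" and ?V = "\<lambda>i. feature \<phi> (x i)" and ?m = "real CARD('m)"
  have e: "(?w i * (u (x i) - lincomb \<phi> c (x i)))\<^sup>2
      = (?w i * u (x i))\<^sup>2 - 2 * (sqrt ?m * ((?w i * u (x i)) * (c \<bullet> ?V i))) + ?m * (?V i \<bullet> c)\<^sup>2" for i
  proof -
    have "(?w i * (u (x i) - lincomb \<phi> c (x i)))\<^sup>2 = (?w i * u (x i) - sqrt ?m * (?V i \<bullet> c))\<^sup>2"
      by (simp add: right_diff_distrib weighted_lincomb)
    also have "\<dots> = (?w i * u (x i))\<^sup>2 - 2 * ((?w i * u (x i)) * (sqrt ?m * (?V i \<bullet> c))) + (sqrt ?m)\<^sup>2 * (?V i \<bullet> c)\<^sup>2"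
      by (simp add: power2_diff power_mult_distrib)
    finally show ?thesis by (simp add: inner_commute[of c] ac_simps)
  qed
  let ?uV = "\<Sum>i\<in>I. (?w i * u (x i)) * (c \<bullet> ?V i)"
  have "(\<Sum>i\<in>I. (?w i * (u (x i) - lincomb \<phi> c (x i)))\<^sup>2)
      = (\<Sum>i\<in>I. (?w i * u (x i))\<^sup>2) - 2 * (sqrt ?m * ?uV) + ?m * (\<Sum>i\<in>I. (?V i \<bullet> c)\<^sup>2)"
    unfolding e by (simp only: sum.distrib sum_subtractf sum_distrib_left)
  moreover have "c \<bullet> b x I = sqrt ?m / card I * ?uV"
    by (simp add: b_def inner_sum_right)
  ultimately show ?thesis
    unfolding emp_norm_square inner_gram by (simp add: diff_divide_distrib add_divide_distrib)
qed

text \<open>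
  The Gram matrix is at least \<open>1 - \<delta>\<close>, hence invertible.  The solution \<open>c\<close> of the normal
  equations satisfies the Pythagorean identity, which makes it the only minimizer and bounds
  its distance to any other coefficient vector \<open>d\<close> by the empirical error of \<open>d\<close>.
\<close>
lemma lsq_proj_eq_lincomb:
  fixes \<phi> :: "'m::finite \<Rightarrow> 'a \<Rightarrow> real"
  assumes Z: "Zdev \<phi> x I \<le> \<delta>" and \<delta>: "\<delta> < 1"
  obtains c where "lsq_proj \<phi> x I u = lincomb \<phi> c"
    and "\<And>d. (1 - \<delta>) * ((c - d) \<bullet> (c - d)) \<le> (emp_norm \<phi> x I (\<lambda>t. u t - lincomb \<phi> d t))\<^sup>2"
proof -
  let ?G = "gram \<phi> x I" and ?E = "\<lambda>d. (emp_norm \<phi> x I (\<lambda>t. u t - lincomb \<phi> d t))\<^sup>2"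
  have lin: "linear ((*v) ?G)" by (rule matrix_vector_mul_linear)
  have ge: "(1 - \<delta>) * (z \<bullet> z) \<le> z \<bullet> (?G *v z)" for z by (rule inner_gram_ge[OF Z])
  have sym: "y \<bullet> (?G *v z) = z \<bullet> (?G *v y)" for y z
    unfolding gram_mult_vec
    by (simp add: inner_sum_right rank_one_def inner_commute mult.commute)
  define b where "b = (sqrt (CARD('m)) / card I) *\<^sub>R (\<Sum>i\<in>I. (sqrt (weight \<phi> (x i)) * u (x i)) *\<^sub>R feature \<phi> (x i))"
  have "inj ((*v) ?G)"
  proof (subst linear_injective_0[OF lin], safe)
    fix z assume "?G *v z = 0"
    then have "(1 - \<delta>) * (z \<bullet> z) \<le> 0" using ge[of z] by simp
    then have "z \<bullet> z \<le> 0" using \<delta> by (simp add: mult_le_0_iff)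
    then show "z = 0" by (metis inner_ge_zero inner_eq_zero_iff order_antisym)
  qed
  then obtain c where c: "?G *v c = b"
    using linear_injective_imp_surjective[OF lin] by (metis surjD)
  have pyth: "?E d = ?E c + (c - d) \<bullet> (?G *v (c - d))" for d
    unfolding emp_norm_square_diff_lincomb b_def[symmetric] c[symmetric]
    by (simp add: linear_diff[OF lin] inner_diff_left inner_diff_right sym[of d c])
  have pd: "0 \<le> (c - d) \<bullet> (?G *v (c - d))" for d
  proof -
    have "0 \<le> (1 - \<delta>) * ((c - d) \<bullet> (c - d))" using \<delta> by simp
    then show ?thesis using ge[of "c - d"] by linarith
  qed
  have le_iff: "emp_norm \<phi> x I f \<le> emp_norm \<phi> x I g \<longleftrightarrow> (emp_norm \<phi> x I f)\<^sup>2 \<le> (emp_norm \<phi> x I g)\<^sup>2" for f g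
    by (rule power_mono_iff[symmetric]) (simp_all add: emp_norm_def sum_nonneg weight_nonneg)
  let ?f = "\<lambda>v. emp_norm \<phi> x I (\<lambda>t. u t - v t)"
  have "is_arg_min ?f (\<lambda>v. v \<in> basis_span \<phi>) (lincomb \<phi> c)"
    unfolding is_arg_min_linorder basis_span_eq_range_lincomb le_iff
  proof (intro conjI allI impI rangeI)
    fix v assume "v \<in> range (lincomb \<phi>)"
    then obtain d where "v = lincomb \<phi> d" by blast
    then show "?E c \<le> (emp_norm \<phi> x I (\<lambda>t. u t - v t))\<^sup>2" using pyth[of d] pd[of d] by simp
  qed
  then have "is_arg_min ?f (\<lambda>v. v \<in> basis_span \<phi>) (lsq_proj \<phi> x I u)"
    unfolding lsq_proj_def arg_min_on_def arg_min_def
    by (rule someI[of "is_arg_min ?f (\<lambda>v. v \<in> basis_span \<phi>)"])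
  then have span: "lsq_proj \<phi> x I u \<in> range (lincomb \<phi>)" and "?f (lsq_proj \<phi> x I u) \<le> ?f (lincomb \<phi> c)"
    by (auto simp: is_arg_min_linorder basis_span_eq_range_lincomb)
  then obtain d where d: "lsq_proj \<phi> x I u = lincomb \<phi> d" and "?E d \<le> ?E c"
    by (auto simp: le_iff)
  then have "(1 - \<delta>) * ((c - d) \<bullet> (c - d)) \<le> 0" using pyth[of d] ge[of "c - d"] by linarith
  then have "(c - d) \<bullet> (c - d) \<le> 0" using \<delta> by (simp add: mult_le_0_iff)
  then have "c = d" by (metis inner_ge_zero inner_eq_zero_iff order_antisym right_minus_eq)
  show thesis
  proof
    show "lsq_proj \<phi> x I u = lincomb \<phi> c" using d \<open>c = d\<close> by simp
    fix d'
    show "(1 - \<delta>) * ((c - d') \<bullet> (c - d')) \<le> ?E d'"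
      using pyth[of d'] ge[of "c - d'"] zero_le_power2[of "emp_norm \<phi> x I (\<lambda>t. u t - lincomb \<phi> c t)"]
      by linarith
  qed
qed

context orthonormal_system begin

lemma integrable_mult_L2:
  assumes "f \<in> L2_space \<mu>" "g \<in> L2_space \<mu>"
  shows "integrable \<mu> (\<lambda>x. f x * g x)"
proof (rule Bochner_Integration.integrable_bound)
  show "integrable \<mu> (\<lambda>x. (f x)\<^sup>2 + (g x)\<^sup>2)" using assms by (auto simp: L2_space_def)
  show "(\<lambda>x. f x * g x) \<in> borel_measurable \<mu>" using assms by (auto simp: L2_space_def)
  have "\<bar>a * b\<bar> \<le> a\<^sup>2 + b\<^sup>2" for a b :: real
  proof -
    have "2 * (\<bar>a\<bar> * \<bar>b\<bar>) \<le> a\<^sup>2 + b\<^sup>2" using sum_squares_bound[of "\<bar>a\<bar>" "\<bar>b\<bar>"] by simp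
    moreover have "0 \<le> \<bar>a\<bar> * \<bar>b\<bar>" by simp
    ultimately show ?thesis unfolding abs_mult by linarith
  qed
  then show "AE x in \<mu>. norm (f x * g x) \<le> norm ((f x)\<^sup>2 + (g x)\<^sup>2)" by simp
qed

lemma phi_L2: "\<phi> j \<in> L2_space \<mu>"
  using orthonormal by (auto simp: L2_orthonormal_def)

definition proj_coeffs :: "('a \<Rightarrow> real) \<Rightarrow> real^'m" where
  "proj_coeffs u = (\<chi> j. L2_inner \<mu> u (\<phi> j))"

lemma L2_proj_eq_lincomb: "L2_proj \<mu> \<phi> u = lincomb \<phi> (proj_coeffs u)"
  by (simp add: L2_proj_def lincomb_def[abs_def] proj_coeffs_def)

lemma integral_diff_lincomb_square:
  assumes u: "u \<in> L2_space \<mu>"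
  shows "integrable \<mu> (\<lambda>x. (u x - lincomb \<phi> c x)\<^sup>2)"
    and "(\<integral>x. (u x - lincomb \<phi> c x)\<^sup>2 \<partial>\<mu>)
      = (\<integral>x. (u x)\<^sup>2 \<partial>\<mu>) - proj_coeffs u \<bullet> proj_coeffs u + (c - proj_coeffs u) \<bullet> (c - proj_coeffs u)"
proof -
  have eq: "(u x - lincomb \<phi> c x)\<^sup>2 = (u x)\<^sup>2 - 2 * (\<Sum>j\<in>UNIV. c $ j * (u x * \<phi> j x))
      + (\<Sum>j\<in>UNIV. \<Sum>k\<in>UNIV. (c $ j * c $ k) * (\<phi> j x * \<phi> k x))" for x
  proof -
    have "(lincomb \<phi> c x)\<^sup>2 = (\<Sum>j\<in>UNIV. \<Sum>k\<in>UNIV. (c $ j * c $ k) * (\<phi> j x * \<phi> k x))"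
      by (simp add: lincomb_def power2_eq_square sum_product ac_simps)
    moreover have "u x * lincomb \<phi> c x = (\<Sum>j\<in>UNIV. c $ j * (u x * \<phi> j x))"
      by (simp add: lincomb_def sum_distrib_left ac_simps)
    ultimately show ?thesis by (simp add: power2_diff mult.assoc)
  qed
  have int: "integrable \<mu> (\<lambda>x. (u x)\<^sup>2)" "integrable \<mu> (\<lambda>x. u x * \<phi> j x)" "integrable \<mu> (\<lambda>x. \<phi> j x * \<phi> k x)" for j k
    using u integrable_mult_L2 phi_L2 by (auto simp: L2_space_def)
  show "integrable \<mu> (\<lambda>x. (u x - lincomb \<phi> c x)\<^sup>2)" unfolding eq using int by simp
  have "(\<integral>x. (u x - lincomb \<phi> c x)\<^sup>2 \<partial>\<mu>) = (\<integral>x. (u x)\<^sup>2 \<partial>\<mu>) - 2 * (c \<bullet> proj_coeffs u) + c \<bullet> c"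
    unfolding eq using int
    by (simp add: integral_phi_mult inner_vec_def proj_coeffs_def L2_inner_def
        if_distrib[of "\<lambda>r. _ * r"] cong: if_cong)
  then show "(\<integral>x. (u x - lincomb \<phi> c x)\<^sup>2 \<partial>\<mu>)
      = (\<integral>x. (u x)\<^sup>2 \<partial>\<mu>) - proj_coeffs u \<bullet> proj_coeffs u + (c - proj_coeffs u) \<bullet> (c - proj_coeffs u)"
    by (simp add: inner_diff_left inner_diff_right inner_commute)
qed

lemma L2_norm_square: "(L2_norm \<mu> v)\<^sup>2 = (\<integral>x. (v x)\<^sup>2 \<partial>\<mu>)"
  by (simp add: L2_norm_def)

text \<open>
  By orthogonality the excess over the best approximation is the squared distance of the
  coefficients of the two projections, which \<open>lsq_proj_eq_lincomb\<close> bounds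
  by the empirical norm of the residual of the orthogonal projection.
\<close>
lemma lsq_proj_error_le:
  assumes u: "u \<in> L2_space \<mu>" and Z: "Zdev \<phi> x I \<le> \<delta>" and \<delta>: "\<delta> < 1"
  shows "(L2_norm \<mu> (\<lambda>t. u t - lsq_proj \<phi> x I u t))\<^sup>2
    \<le> (L2_norm \<mu> (\<lambda>t. u t - L2_proj \<mu> \<phi> u t))\<^sup>2
      + inverse (1 - \<delta>) * (emp_norm \<phi> x I (\<lambda>t. u t - L2_proj \<mu> \<phi> u t))\<^sup>2"
proof -
  obtain c where c: "lsq_proj \<phi> x I u = lincomb \<phi> c"
    and le: "\<And>d. (1 - \<delta>) * ((c - d) \<bullet> (c - d)) \<le> (emp_norm \<phi> x I (\<lambda>t. u t - lincomb \<phi> d t))\<^sup>2"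
    using lsq_proj_eq_lincomb[OF Z \<delta>] by blast
  have "(c - proj_coeffs u) \<bullet> (c - proj_coeffs u)
      \<le> inverse (1 - \<delta>) * (emp_norm \<phi> x I (\<lambda>t. u t - L2_proj \<mu> \<phi> u t))\<^sup>2"
    using le[of "proj_coeffs u"] \<delta> by (simp add: L2_proj_eq_lincomb field_simps)
  then show ?thesis
    by (simp add: c L2_norm_square L2_proj_eq_lincomb integral_diff_lincomb_square[OF u])
qed

end

text \<open>
  Passing to a subsample loses at most the ratio of the sample sizes, whatever the dependence
  of \<open>K\<close> on the sample; this is the only way in which the greedy selection enters the error bound.
\<close>
lemma emp_norm_square_subset_le:
  assumes "K \<subseteq> I" "finite I" "0 < k" "k \<le> card K"
  shows "(emp_norm \<phi> x K v)\<^sup>2 \<le> real (card I) / real k * (emp_norm \<phi> x I v)\<^sup>2"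
proof -
  let ?s = "\<lambda>J. \<Sum>i\<in>J. (sqrt (weight \<phi> (x i)) * v (x i))\<^sup>2"
  have I: "0 < card I" using assms card_mono[of I K] by linarith
  have "(emp_norm \<phi> x K v)\<^sup>2 \<le> 1 / real k * ?s K"
    unfolding emp_norm_square using assms by (intro mult_right_mono divide_left_mono) (auto intro: sum_nonneg)
  also have "\<dots> \<le> 1 / real k * ?s I" using assms by (intro mult_left_mono sum_mono2) auto
  also have "\<dots> = real (card I) / real k * (emp_norm \<phi> x I v)\<^sup>2" using I by (simp add: emp_norm_square)
  finally show ?thesis .
qed

lemma greedy_output_invariant:
  assumes "greedy_output \<phi> \<delta> k n x K" and "Zdev \<phi> x {1..n} \<le> \<delta>" and "k \<le> n"
  shows "K \<subseteq> {1..n}" "k \<le> card K" "Zdev \<phi> x K \<le> \<delta>"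
proof -
  have "(greedy_step \<phi> \<delta> k x)\<^sup>*\<^sup>* {1..n} K" using assms(1) by (simp add: greedy_output_def)
  then have "K \<subseteq> {1..n} \<and> k \<le> card K \<and> Zdev \<phi> x K \<le> \<delta>"
  proof (induction rule: rtranclp_induct)
    case base
    then show ?case using assms by simp
  next
    case (step K K')
    then obtain i where "i \<in> K" "Zdev \<phi> x (K - {i}) \<le> \<delta>" "k < card K" "K' = K - {i}"
      by (auto simp: greedy_step_def is_arg_min_def)
    then show ?case using step by auto
  qed
  then show "K \<subseteq> {1..n}" "k \<le> card K" "Zdev \<phi> x K \<le> \<delta>" by auto
qed

section \<open>The best of several independent samples\<close>

text \<open>
  Measurability of \<open>f\<close> would demand that all its values lie in the space of \<open>N\<close>.  Here \<open>f\<close> may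
  leave that space outside the support of \<open>p\<close>, as the sample map \<open>\<lambda>i. y i\<close> does for
  \<open>i\<close> outside the index range, where \<open>y i\<close> is undefined.
\<close>
lemma emeasure_distr_measure_pmf:
  fixes f :: "'i \<Rightarrow> 'x" and N :: "'x measure"
  assumes A: "A \<in> sets N"
  shows "emeasure (distr (measure_pmf p) N f) A = emeasure (measure_pmf p) (f -` A)"
proof -
  let ?\<mu> = "\<lambda>A. emeasure (measure_pmf p) (f -` A \<inter> space (measure_pmf p))"
  have "emeasure (distr (measure_pmf p) N f) A = ?\<mu> A"
  proof (rule emeasure_measure_of[OF distr_def])
    show "sets N \<subseteq> Pow (space N)" by (rule sets.space_closed)
    show "positive (sets (distr (measure_pmf p) N f)) ?\<mu>" by (simp add: positive_def)
    show "countably_additive (sets (distr (measure_pmf p) N f)) ?\<mu>"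
    proof (rule countably_additiveI)
      fix B :: "nat \<Rightarrow> 'x set" assume "disjoint_family B"
      then have "disjoint_family (\<lambda>i. f -` B i)" by (auto simp: disjoint_family_on_def)
      then show "(\<Sum>i. ?\<mu> (B i)) = ?\<mu> (\<Union>i. B i)"
        by (simp add: vimage_UN suminf_emeasure)
    qed
  qed (use A in auto)
  then show ?thesis by simp
qed

lemma prob_space_distr_measure_pmf:
  assumes "\<And>i. i \<in> set_pmf p \<Longrightarrow> f i \<in> space N"
  shows "prob_space (distr (measure_pmf p) N f)"
proof
  have "AE i in measure_pmf p. i \<in> f -` space N" using assms by (simp add: AE_measure_pmf_iff)
  then have "emeasure (measure_pmf p) (f -` space N) = 1"
    by (intro measure_pmf.emeasure_eq_1_AE) auto
  then show "emeasure (distr (measure_pmf p) N f) (space (distr (measure_pmf p) N f)) = 1"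
    by (simp add: emeasure_distr_measure_pmf)
qed

lemma AE_distr_measure_pmf:
  assumes meas: "{x \<in> space N. P x} \<in> sets N"
    and P: "\<And>i. i \<in> set_pmf p \<Longrightarrow> f i \<in> space N \<Longrightarrow> P (f i)"
  shows "AE x in distr (measure_pmf p) N f. P x"
proof (rule AE_I')
  let ?B = "space N - {x \<in> space N. P x}"
  have "emeasure (measure_pmf p) (f -` ?B) = 0"
    using P by (auto simp: measure_pmf.emeasure_eq_measure measure_pmf_zero_iff)
  then show "?B \<in> null_sets (distr (measure_pmf p) N f)"
    using meas by (auto simp: null_sets_def emeasure_distr_measure_pmf)
qed auto

text \<open>
  Equivalently \<open>t i \<le> 1 - (\<Prod>j\<in>I. 1 - t j)\<close>: a bound of a maximum by a function of product form,
  whose expectation factorizes under independence.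
\<close>
lemma prod_one_minus_le:
  fixes t :: "'i \<Rightarrow> real"
  assumes "finite I" "i \<in> I" "\<And>j. j \<in> I \<Longrightarrow> 0 \<le> t j \<and> t j \<le> 1"
  shows "(\<Prod>j\<in>I. 1 - t j) \<le> 1 - t i"
proof -
  have "(\<Prod>j\<in>I. 1 - t j) = (1 - t i) * (\<Prod>j\<in>I - {i}. 1 - t j)" using assms by (intro prod.remove)
  also have "\<dots> \<le> (1 - t i) * 1" using assms by (intro mult_left_mono prod_le_1) auto
  finally show ?thesis by simp
qed

text \<open>
  Out of \<open>M\<close> independent draws from \<open>Q\<close> one keeps a draw that minimizes \<open>Z\<close>, breaking ties uniformly.
\<close>
locale best_of_iid = prob_space Q for Q :: "'x measure" +
  fixes Z :: "'x \<Rightarrow> real" and M :: nat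
  assumes Z_measurable[measurable]: "Z \<in> borel_measurable Q" and M_pos: "1 \<le> M"
begin

abbreviation "samples \<equiv> PiM {1..M} (\<lambda>_. Q)"

definition best :: "(nat \<Rightarrow> 'x) \<Rightarrow> nat set" where
  "best y = {i. is_arg_min (\<lambda>i. Z (y i)) (\<lambda>i. i \<in> {1..M}) i}"

definition pick :: "(nat \<Rightarrow> 'x) \<Rightarrow> 'x measure" where
  "pick y = distr (measure_pmf (pmf_of_set (best y))) Q (\<lambda>i. y i)"

definition best_law :: "'x measure" where
  "best_law = samples \<bind> pick"

lemma mem_best_iff: "i \<in> best y \<longleftrightarrow> i \<in> {1..M} \<and> (\<forall>j\<in>{1..M}. Z (y i) \<le> Z (y j))"
  by (auto simp: best_def is_arg_min_linorder)

lemma finite_best: "finite (best y)" and best_nonempty: "best y \<noteq> {}" and best_subset: "best y \<subseteq> {1..M}"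
proof -
  show sub: "best y \<subseteq> {1..M}" by (auto simp: mem_best_iff)
  then show "finite (best y)" by (rule finite_subset) simp
  have "{1..M} \<noteq> {}" using M_pos by auto
  from ex_is_arg_min_if_finite[OF _ this, of "\<lambda>i. Z (y i)"] show "best y \<noteq> {}" by (auto simp: best_def)
qed

lemma set_pmf_best: "set_pmf (pmf_of_set (best y)) = best y"
  by (simp add: best_nonempty finite_best)

lemma sets_pick[simp]: "sets (pick y) = sets Q" and space_pick[simp]: "space (pick y) = space Q"
  by (simp_all add: pick_def)

lemma component_in_space: "y \<in> space samples \<Longrightarrow> i \<in> {1..M} \<Longrightarrow> y i \<in> space Q"
  by (auto simp: space_PiM)

lemma prob_space_pick: "y \<in> space samples \<Longrightarrow> prob_space (pick y)"
  unfolding pick_def using best_subset[of y]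
  by (intro prob_space_distr_measure_pmf component_in_space) (auto simp: set_pmf_best subset_eq)

lemma emeasure_pick:
  assumes "A \<in> sets Q"
  shows "emeasure (pick y) A = ennreal ((\<Sum>i=1..M. indicator (best y) i * indicator A (y i)) / (\<Sum>i=1..M. indicator (best y) i))"
proof -
  have sub: "best y \<inter> {1..M} = best y" using best_subset by blast
  have ind: "(\<Sum>i=1..M. indicator S i) = real (card (S \<inter> {1..M}))" for S
    by (simp add: indicator_def of_bool_def sum.If_cases Int_commute)
  have "emeasure (pick y) A = ennreal (card (best y \<inter> (\<lambda>i. y i) -` A) / card (best y))"
    using assms by (simp add: pick_def emeasure_distr_measure_pmf emeasure_pmf_of_set finite_best best_nonempty)
  also have "real (card (best y)) = (\<Sum>i=1..M. indicator (best y) i)"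
    unfolding ind sub ..
  also have "real (card (best y \<inter> (\<lambda>i. y i) -` A)) = (\<Sum>i=1..M. indicator (best y \<inter> y -` A) i)"
    unfolding ind using sub by (metis Int_assoc Int_commute)
  also have "\<dots> = (\<Sum>i=1..M. indicator (best y) i * indicator A (y i))"
    by (intro sum.cong) (auto simp: indicator_def)
  finally show ?thesis .
qed

lemma measurable_pick: "pick \<in> measurable samples (subprob_algebra Q)"
proof (rule measurable_subprob_algebra)
  show "subprob_space (pick y)" if "y \<in> space samples" for y
    by (rule prob_space_imp_subprob_space[OF prob_space_pick[OF that]])
  fix A assume A[measurable]: "A \<in> sets Q"
  have comp[measurable]: "(\<lambda>y. y i) \<in> measurable samples Q" if "i \<in> {1..M}" for i
    using that by (rule measurable_component_singleton)
  have b: "(\<lambda>y. indicator (best y) i :: real) \<in> borel_measurable samples" if i: "i \<in> {1..M}" for i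
  proof -
    have "{y \<in> space samples. \<forall>j\<in>{1..M}. Z (y i) \<le> Z (y j)} \<in> sets samples"
      using i by (intro sets.sets_Collect_finite_All borel_measurable_le
          measurable_compose[OF comp Z_measurable]) auto
    moreover have "indicator (best y) i = (indicator {y \<in> space samples. \<forall>j\<in>{1..M}. Z (y i) \<le> Z (y j)} y :: real)"
      if "y \<in> space samples" for y
      using i that by (auto simp: indicator_def mem_best_iff)
    ultimately show ?thesis
      by (subst measurable_cong) (auto intro: borel_measurable_indicator)
  qed
  have a: "(\<lambda>y. indicator A (y i) :: real) \<in> borel_measurable samples" if "i \<in> {1..M}" for i
    by (rule measurable_compose[OF comp[OF that] borel_measurable_indicator[OF A]])
  show "(\<lambda>y. emeasure (pick y) A) \<in> borel_measurable samples"
    unfolding emeasure_pick[OF A]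
    by (intro measurable_compose[OF _ measurable_ennreal] borel_measurable_divide borel_measurable_sum
        borel_measurable_times a b)
qed simp

lemma prob_space_samples: "prob_space samples"
  by (rule prob_space_PiM) (rule prob_space_axioms)

lemma samples_nonempty: "space samples \<noteq> {}"
  by (rule prob_space.not_empty[OF prob_space_samples])

lemma sets_best_law[simp, measurable_cong]: "sets best_law = sets Q"
  unfolding best_law_def by (rule sets_bind[OF _ samples_nonempty]) simp

lemma space_best_law[simp]: "space best_law = space Q"
  by (rule sets_eq_imp_space_eq) simp

lemma prob_space_best_law: "prob_space best_law"
  unfolding best_law_def
  by (intro prob_space.prob_space_bind[OF prob_space_samples _ measurable_pick] AE_I2 prob_space_pick)

text \<open>
  The selected draw is one of the \<open>M\<close> draws, so a function of it is at most any bound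
  that is common to all minimizers.
\<close>
lemma nn_integral_best_law_le:
  assumes f[measurable]: "f \<in> borel_measurable Q"
    and h: "\<And>y i. y \<in> space samples \<Longrightarrow> i \<in> best y \<Longrightarrow> f (y i) \<le> h y"
  shows "(\<integral>\<^sup>+x. f x \<partial>best_law) \<le> (\<integral>\<^sup>+y. h y \<partial>samples)"
proof -
  have "(\<integral>\<^sup>+x. f x \<partial>best_law) = (\<integral>\<^sup>+y. (\<integral>\<^sup>+x. f x \<partial>pick y) \<partial>samples)"
    unfolding best_law_def by (rule nn_integral_bind[OF f measurable_pick])
  also have "\<dots> \<le> (\<integral>\<^sup>+y. h y \<partial>samples)"
  proof (rule nn_integral_mono)
    fix y assume y: "y \<in> space samples"
    have "{x \<in> space Q. f x \<le> h y} \<in> sets Q" by measurable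
    then have "AE x in pick y. f x \<le> h y"
      unfolding pick_def using h[OF y] by (intro AE_distr_measure_pmf) (auto simp: set_pmf_best)
    then have "(\<integral>\<^sup>+x. f x \<partial>pick y) \<le> (\<integral>\<^sup>+x. h y \<partial>pick y)" by (rule nn_integral_mono_AE)
    also have "\<dots> = h y" using prob_space.emeasure_space_1[OF prob_space_pick[OF y]] by simp
    finally show "(\<integral>\<^sup>+x. f x \<partial>pick y) \<le> h y" .
  qed
  finally show ?thesis .
qed

text \<open>
  The best draw exceeds \<open>\<delta>\<close> only if all \<open>M\<close> independent draws do.
\<close>
lemma prob_best_law_gt_le:
  "measure best_law {x \<in> space Q. \<delta> < Z x} \<le> measure Q {x \<in> space Q. \<delta> < Z x} ^ M"
proof -
  interpret B: prob_space best_law by (rule prob_space_best_law)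
  interpret product_sigma_finite "\<lambda>_. Q" ..
  let ?A = "{x \<in> space Q. \<delta> < Z x}"
  have A: "?A \<in> sets Q" by measurable
  have "ennreal (measure best_law ?A) = (\<integral>\<^sup>+x. indicator ?A x \<partial>best_law)"
    using A by (simp add: B.emeasure_eq_measure)
  also have "\<dots> \<le> (\<integral>\<^sup>+y. (\<Prod>i\<in>{1..M}. indicator ?A (y i)) \<partial>samples)"
  proof (rule nn_integral_best_law_le)
    show "indicator ?A \<in> borel_measurable Q" using A by simp
    fix y i assume y: "y \<in> space samples" and i: "i \<in> best y"
    show "(indicator ?A (y i) :: ennreal) \<le> (\<Prod>i\<in>{1..M}. indicator ?A (y i))"
    proof (cases "\<delta> < Z (y i)")
      case True
      then have "y j \<in> ?A" if "j \<in> {1..M}" for j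
        using i that component_in_space[OF y that] by (auto simp: mem_best_iff intro: less_le_trans)
      then have "(\<Prod>i\<in>{1..M}. indicator ?A (y i)) = (1::ennreal)" by (intro prod.neutral) auto
      then show ?thesis by (simp add: indicator_def)
    qed simp
  qed
  also have "\<dots> = (\<Prod>i\<in>{1..M}. (\<integral>\<^sup>+x. indicator ?A x \<partial>Q))"
    using A by (intro product_nn_integral_prod) auto
  also have "\<dots> = ennreal (measure Q ?A ^ M)"
    using A by (simp add: emeasure_eq_measure ennreal_power)
  finally show ?thesis by (simp add: ennreal_le_iff)
qed

definition cond_law :: "real \<Rightarrow> 'x measure" where
  "cond_law \<delta> = uniform_measure best_law {x \<in> space Q. Z x \<le> \<delta>}"

lemma AE_cond_law: "AE x in cond_law \<delta>. Z x \<le> \<delta>"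
  unfolding cond_law_def by (rule AE_uniform_measureI) auto

lemma nn_integral_cond_law_le:
  assumes f: "f \<in> borel_measurable Q" and \<eta>: "measure Q {x \<in> space Q. \<delta> < Z x} \<le> \<eta>" "\<eta> < 1"
  shows "(\<integral>\<^sup>+x. f x \<partial>cond_law \<delta>) \<le> ennreal (inverse (1 - \<eta> ^ M)) * (\<integral>\<^sup>+x. f x \<partial>best_law)"
proof -
  interpret B: prob_space best_law by (rule prob_space_best_law)
  let ?A = "{x \<in> space Q. Z x \<le> \<delta>}"
  have A: "?A \<in> sets best_law" by simp
  have "measure best_law {x \<in> space Q. \<delta> < Z x} \<le> \<eta> ^ M"
    using prob_best_law_gt_le power_mono[OF \<eta>(1) measure_nonneg] by (rule order_trans)
  moreover have "{x \<in> space Q. \<delta> < Z x} = space best_law - ?A" by auto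
  ultimately have P: "1 - \<eta> ^ M \<le> measure best_law ?A"
    using B.prob_compl[OF A] by simp
  have "0 \<le> \<eta>" using \<eta>(1) measure_nonneg order_trans by blast
  then have "\<eta> ^ M < 1" using \<eta>(2) M_pos by (simp add: power_less_one_iff)
  then have pos: "0 < 1 - \<eta> ^ M" by simp
  have "(\<integral>\<^sup>+x. f x \<partial>cond_law \<delta>) = (\<integral>\<^sup>+x. f x * indicator ?A x \<partial>best_law) / emeasure best_law ?A"
    unfolding cond_law_def using f A by (intro nn_integral_uniform_measure) auto
  also have "\<dots> = ennreal (inverse (measure best_law ?A)) * (\<integral>\<^sup>+x. f x * indicator ?A x \<partial>best_law)"
    using P pos by (simp add: divide_ennreal_def inverse_ennreal B.emeasure_eq_measure mult.commute)
  also have "\<dots> \<le> ennreal (inverse (1 - \<eta> ^ M)) * (\<integral>\<^sup>+x. f x \<partial>best_law)"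
    using P pos by (intro mult_mono nn_integral_mono ennreal_leI le_imp_inverse_le)
      (auto simp: indicator_def)
  finally show ?thesis .
qed

lemma nn_integral_component:
  assumes "f \<in> borel_measurable Q" "i \<in> {1..M}"
  shows "(\<integral>\<^sup>+y. f (y i) \<partial>samples) = (\<integral>\<^sup>+x. f x \<partial>Q)"
proof -
  have "(\<integral>\<^sup>+x. f x \<partial>Q) = (\<integral>\<^sup>+x. f x \<partial>distr samples Q (\<lambda>y. y i))"
    using assms(2) prob_space_axioms by (subst distr_PiM_component) auto
  also have "\<dots> = (\<integral>\<^sup>+y. f (y i) \<partial>samples)"
    using assms by (subst nn_integral_distr) auto
  finally show ?thesis by simp
qed

lemma nn_integral_best_law_le_sum:
  assumes f: "f \<in> borel_measurable Q"
  shows "(\<integral>\<^sup>+x. f x \<partial>best_law) \<le> of_nat M * (\<integral>\<^sup>+x. f x \<partial>Q)"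
proof -
  have "(\<integral>\<^sup>+x. f x \<partial>best_law) \<le> (\<integral>\<^sup>+y. (\<Sum>i=1..M. f (y i)) \<partial>samples)"
    by (intro nn_integral_best_law_le[OF f] member_le_sum) (use best_subset in blast, auto)
  also have "\<dots> = (\<Sum>i=1..M. (\<integral>\<^sup>+y. f (y i) \<partial>samples))"
    by (intro nn_integral_sum measurable_compose[OF _ f] measurable_component_singleton)
  also have "\<dots> = (\<Sum>i=1..M. (\<integral>\<^sup>+x. f x \<partial>Q))"
    by (intro sum.cong refl nn_integral_component f)
  also have "\<dots> = of_nat M * (\<integral>\<^sup>+x. f x \<partial>Q)" by simp
  finally show ?thesis .
qed

text \<open>
  Since \<open>f\<close> is bounded, its maximum over the draws is at most \<open>B * (1 - \<Prod>\<^sub>i (1 - f (y i) / B))\<close>, which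
  improves on the sum when \<open>M\<close> times the mean of \<open>f\<close> is comparable to \<open>B\<close>.  Bounding the selected
  value by the maximum covers every correlation between \<open>Z\<close> and \<open>f\<close>.
\<close>
lemma nn_integral_best_law_bounded_le:
  assumes f[measurable]: "f \<in> borel_measurable Q" and B: "0 < B"
    and f01: "\<And>x. x \<in> space Q \<Longrightarrow> 0 \<le> f x \<and> f x \<le> B"
  shows "(\<integral>\<^sup>+x. ennreal (f x) \<partial>best_law) \<le> ennreal (B * (1 - (1 - (\<integral>x. f x \<partial>Q) / B) ^ M))"
proof -
  interpret product_sigma_finite "\<lambda>_. Q" ..
  interpret S: prob_space samples by (rule prob_space_samples)
  let ?h = "\<lambda>y. B * (1 - (\<Prod>i\<in>{1..M}. 1 - f (y i) / B))"
  have int: "integrable Q (\<lambda>x. 1 - f x / B)"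
    using B f01 by (intro integrable_const_bound[of _ 1]) (auto simp: divide_le_eq)
  have intf: "integrable Q f"
    using f01 by (intro integrable_const_bound[of _ B]) auto
  have t: "0 \<le> f (y i) / B \<and> f (y i) / B \<le> 1" if "y \<in> space samples" "i \<in> {1..M}" for y i
    using f01[OF component_in_space[OF that]] B by simp
  have intp: "integrable samples (\<lambda>y. \<Prod>i\<in>{1..M}. 1 - f (y i) / B)"
    using int by (intro product_integrable_prod) auto
  have "(\<integral>\<^sup>+x. ennreal (f x) \<partial>best_law) \<le> (\<integral>\<^sup>+y. ennreal (?h y) \<partial>samples)"
  proof (rule nn_integral_best_law_le)
    fix y i assume y: "y \<in> space samples" and "i \<in> best y"
    then have "i \<in> {1..M}" using best_subset by blast
    from prod_one_minus_le[OF _ this, of "\<lambda>i. f (y i) / B"] t[OF y]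
    have "f (y i) / B \<le> 1 - (\<Prod>i\<in>{1..M}. 1 - f (y i) / B)" by simp
    then show "ennreal (f (y i)) \<le> ennreal (?h y)" using B by (intro ennreal_leI) (simp add: field_simps)
  qed simp
  also have "\<dots> = ennreal (\<integral>y. ?h y \<partial>samples)"
  proof (intro nn_integral_eq_integral AE_I2)
    show "integrable samples ?h"
      by (intro integrable_mult_right Bochner_Integration.integrable_diff S.integrable_const intp)
    fix y assume "y \<in> space samples"
    then have "(\<Prod>i\<in>{1..M}. 1 - f (y i) / B) \<le> 1" using t by (intro prod_le_1) simp
    then show "0 \<le> ?h y" using B by simp
  qed
  also have "(\<integral>y. ?h y \<partial>samples) = B * (1 - (\<Prod>i\<in>{1..M}. (\<integral>x. 1 - f x / B \<partial>Q)))"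
  proof -
    have "(\<integral>y. 1 - (\<Prod>i\<in>{1..M}. 1 - f (y i) / B) \<partial>samples)
        = (\<integral>y. 1 \<partial>samples) - (\<integral>y. (\<Prod>i\<in>{1..M}. 1 - f (y i) / B) \<partial>samples)"
      by (intro Bochner_Integration.integral_diff S.integrable_const intp)
    also have "(\<integral>y. (\<Prod>i\<in>{1..M}. 1 - f (y i) / B) \<partial>samples) = (\<Prod>i\<in>{1..M}. (\<integral>x. 1 - f x / B \<partial>Q))"
      by (intro product_integral_prod int) auto
    finally show ?thesis using S.prob_space by simp
  qed
  also have "(\<integral>x. 1 - f x / B \<partial>Q) = 1 - (\<integral>x. f x \<partial>Q) / B"
    using intf by (simp add: prob_space)
  finally show ?thesis by simp
qed

end

section \<open>The interpolation constants\<close>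

text \<open>
  The left-hand side is the integral of \<open>M * v ^ (M - 1)\<close> over \<open>[1 - \<beta>, 1]\<close>, and Hoelder's
  inequality with the exponents \<open>1 / \<epsilon>\<close> and \<open>1 / (1 - \<epsilon>)\<close> for this integral gives exactly the constant
  \<open>C_const \<epsilon> M\<close>.  The proof uses the pointwise form of this inequality, Young's inequality, and
  integrates it by comparing derivatives of primitives.
\<close>
lemma best_of_M_scalar:
  fixes \<epsilon> \<beta> :: real
  assumes \<epsilon>: "0 < \<epsilon>" "\<epsilon> \<le> 1" and \<beta>: "0 \<le> \<beta>" "\<beta> \<le> 1" and M: "1 \<le> M"
  shows "1 - (1 - \<beta>) ^ M \<le> C_const \<epsilon> M * rpow \<beta> \<epsilon>"
proof -
  consider "\<beta> = 0" | "\<epsilon> = 1" | "0 < \<beta>" "\<epsilon> < 1" using assms by linarith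
  then show ?thesis
  proof cases
    case 1
    then show ?thesis using \<epsilon> by (simp add: rpow_def)
  next
    case 2
    have "1 + real M * (- \<beta>) \<le> (1 + - \<beta>) ^ M" using \<beta> by (intro Bernoulli_inequality) simp
    then show ?thesis using 2 \<beta> by (simp add: C_const_def rpow_def)
  next
    case 3
    define A where "A = (1 - \<epsilon>) / (M - \<epsilon>)"
    \<comment> \<open>The weights \<open>a\<close> and \<open>b\<close> balance the two terms of Young's inequality after integration: both
      \<open>a * \<beta>\<close> and \<open>b * A\<close> equal the target divided by \<open>M\<close>, and \<open>a powr \<epsilon> * b powr (1 - \<epsilon>)\<close> is 1.\<close>
    define a where "a = (A / \<beta>) powr (1 - \<epsilon>)"
    define b where "b = (\<beta> / A) powr \<epsilon>"
    have A: "0 < A" using 3 M by (simp add: A_def)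
    have a: "0 < a" and b: "0 < b" using A 3 by (auto simp: a_def b_def)
    have ab: "a powr \<epsilon> * b powr (1 - \<epsilon>) = 1"
      using A 3 by (simp add: a_def b_def powr_powr powr_divide ac_simps flip: powr_add)
    have Mr: "(real M - 1) / (1 - \<epsilon>) + 1 = 1 / A" using 3 M by (simp add: A_def field_simps)
    have invA: "1 \<le> 1 / A" using 3 M by (simp add: A_def field_simps)
    have young: "v ^ (M - 1) \<le> \<epsilon> * a + (1 - \<epsilon>) * b * v powr (1 / A - 1)" if "0 < v" for v
    proof -
      let ?q = "v powr ((real M - 1) / (1 - \<epsilon>))"
      have "v ^ (M - 1) = v powr (real M - 1)" using that M by (simp add: powr_realpow[symmetric] of_nat_diff)
      also have "\<dots> = a powr \<epsilon> * (b * ?q) powr (1 - \<epsilon>)"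
        using 3 that ab b by (simp add: powr_mult powr_powr mult.assoc[symmetric])
      also have "\<dots> \<le> \<epsilon> * a + (1 - \<epsilon>) * (b * ?q)"
        using 3 \<epsilon> a b that by (intro Youngs_inequality_0) auto
      also have "(real M - 1) / (1 - \<epsilon>) = 1 / A - 1" using Mr by simp
      finally show ?thesis by (simp add: mult.assoc)
    qed
    let ?f = "\<lambda>t. \<epsilon> * a * t - (1 - \<epsilon>) * b * A * (1 - t) powr (1 / A) + (1 - t) ^ M / M"
    have "?f 0 \<le> ?f \<beta>"
    proof (rule DERIV_nonneg_imp_increasing_open[OF \<beta>(1)])
      fix t assume t: "0 < t" "t < \<beta>"
      then have v: "0 < 1 - t" using \<beta> by simp
      have "(?f has_real_derivative \<epsilon> * a + (1 - \<epsilon>) * b * A * (1 / A * (1 - t) powr (1 / A - 1))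
          - (1 - t) ^ (M - 1)) (at t)"
        using v M by (auto intro!: derivative_eq_intros simp: powr_diff)
      moreover have "0 \<le> \<epsilon> * a + (1 - \<epsilon>) * b * A * (1 / A * (1 - t) powr (1 / A - 1)) - (1 - t) ^ (M - 1)"
        using young[OF v] A by simp
      ultimately show "\<exists>y. (?f has_real_derivative y) (at t) \<and> 0 \<le> y" by blast
    next
      show "continuous_on {0..\<beta>} ?f"
        using A M \<beta> by (intro continuous_intros continuous_on_powr') auto
    qed
    then have "(1 - (1 - \<beta>) ^ M) / M \<le> \<epsilon> * a * \<beta> + (1 - \<epsilon>) * b * A - (1 - \<epsilon>) * b * A * (1 - \<beta>) powr (1 / A)"
      by (simp add: diff_divide_distrib)
    also have "\<dots> \<le> \<epsilon> * (a * \<beta>) + (1 - \<epsilon>) * (b * A)" using 3 A b by (simp add: mult.assoc)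
    also have "\<dots> = A powr (1 - \<epsilon>) * \<beta> powr \<epsilon>"
    proof -
      have "a * \<beta> = A powr (1 - \<epsilon>) * (\<beta> powr 1 / \<beta> powr (1 - \<epsilon>))"
        using A 3 by (simp add: a_def powr_divide)
      also have "\<beta> powr 1 / \<beta> powr (1 - \<epsilon>) = \<beta> powr (1 - (1 - \<epsilon>))" by (rule powr_diff[symmetric])
      finally have "a * \<beta> = A powr (1 - \<epsilon>) * \<beta> powr \<epsilon>" by simp
      moreover have "b * A = \<beta> powr \<epsilon> * (A powr 1 / A powr \<epsilon>)"
        using A 3 by (simp add: b_def powr_divide)
      then have "b * A = A powr (1 - \<epsilon>) * \<beta> powr \<epsilon>"
        unfolding powr_diff[symmetric] by (simp add: mult.commute)
      ultimately show ?thesis by (simp only: distrib_right[symmetric]) simp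
    qed
    finally have "1 - (1 - \<beta>) ^ M \<le> M * (A powr (1 - \<epsilon>) * \<beta> powr \<epsilon>)" using M by (simp add: field_simps)
    also have "\<dots> = C_const \<epsilon> M * rpow \<beta> \<epsilon>"
      using 3 \<epsilon> M by (simp add: C_const_def rpow_def A_def powr_divide)
    finally show ?thesis .
  qed
qed

text \<open>
  Rescaling of \<open>best_of_M_scalar\<close> by the bound \<open>l\<^sup>2\<close> on the squared residual.
\<close>
lemma best_of_M_interpolated:
  fixes l a \<alpha> \<epsilon> :: real
  assumes l: "0 \<le> l" and a: "0 \<le> a" "a \<le> \<alpha>" "a \<le> l\<^sup>2" and \<epsilon>: "0 < \<epsilon>" "\<epsilon> \<le> 1" and M: "1 \<le> M"
  shows "l\<^sup>2 * (1 - (1 - a / l\<^sup>2) ^ M) \<le> C_const \<epsilon> M * rpow l (2 - 2 * \<epsilon>) * rpow \<alpha> \<epsilon>"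
proof -
  have rp: "0 \<le> rpow b e" if "0 \<le> b" for b e using that by (simp add: rpow_def)
  have C: "0 \<le> C_const \<epsilon> M" using \<epsilon> M by (auto simp: C_const_def intro!: mult_nonneg_nonneg divide_nonneg_nonneg rp)
  show ?thesis
  proof (cases "l = 0")
    case True
    then show ?thesis using C a rp[of l] rp[of \<alpha>] l by simp
  next
    case False
    then have l: "0 < l" using l by simp
    have "l\<^sup>2 * (1 - (1 - a / l\<^sup>2) ^ M) \<le> l\<^sup>2 * (C_const \<epsilon> M * rpow (a / l\<^sup>2) \<epsilon>)"
      using a l by (intro mult_left_mono best_of_M_scalar \<epsilon> M) (auto simp: divide_le_eq)
    also have "\<dots> = C_const \<epsilon> M * (l\<^sup>2 powr (1 - \<epsilon>)) * a powr \<epsilon>"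
    proof -
      have "l\<^sup>2 * (a / l\<^sup>2) powr \<epsilon> = l\<^sup>2 powr 1 / l\<^sup>2 powr \<epsilon> * a powr \<epsilon>"
        using a l by (simp add: powr_divide)
      also have "\<dots> = l\<^sup>2 powr (1 - \<epsilon>) * a powr \<epsilon>" by (simp only: powr_diff)
      finally show ?thesis using \<epsilon> by (simp add: rpow_def)
    qed
    also have "l\<^sup>2 powr (1 - \<epsilon>) = rpow l (2 - 2 * \<epsilon>)"
    proof -
      have "l\<^sup>2 = l powr 2" using l by (simp add: powr_numeral)
      then have "l\<^sup>2 powr (1 - \<epsilon>) = l powr (2 - 2 * \<epsilon>)" by (simp add: powr_powr algebra_simps)
      then show ?thesis using l by (simp add: rpow_def)
    qed
    also have "C_const \<epsilon> M * rpow l (2 - 2 * \<epsilon>) * a powr \<epsilon> \<le> C_const \<epsilon> M * rpow l (2 - 2 * \<epsilon>) * rpow \<alpha> \<epsilon>"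
      using a \<epsilon> C rp[of l] l
      by (intro mult_left_mono mult_nonneg_nonneg[of "C_const \<epsilon> M"]) (auto simp: rpow_def[of \<alpha>] intro: powr_mono2)
    finally show ?thesis .
  qed
qed

lemma D_const_ge:
  assumes "0 \<le> L * (1 + c)" "0 \<le> a" "a \<le> \<alpha>" "a \<le> (L * (1 + c))\<^sup>2" "1 \<le> M"
  shows "(L * (1 + c))\<^sup>2 * (1 - (1 - a / (L * (1 + c))\<^sup>2) ^ M) \<le> D_const M L c \<alpha>"
  unfolding D_const_def using assms by (intro cINF_greatest best_of_M_interpolated) auto

section \<open>Error bounds for the boosted sample\<close>

lemma wsup_norm_le_iff:
  "wsup_norm \<mu> \<phi> v \<le> ereal L \<longleftrightarrow> (\<forall>x\<in>space \<mu>. sqrt (weight \<phi> x) * \<bar>v x\<bar> \<le> L)"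
  by (simp add: wsup_norm_def SUP_le_iff)

context orthonormal_system begin

lemma wsup_norm_nonneg: "0 \<le> wsup_norm \<mu> \<phi> v"
proof -
  obtain x where x: "x \<in> space \<mu>" using not_empty by auto
  have "0 \<le> ereal (sqrt (weight \<phi> x) * \<bar>v x\<bar>)" by (simp add: weight_nonneg)
  also have "\<dots> \<le> wsup_norm \<mu> \<phi> v" unfolding wsup_norm_def using x by (rule SUP_upper)
  finally show ?thesis .
qed

text \<open>
  The weighted bound gives \<open>(v x)\<^sup>2 \<le> inverse (weight \<phi> x)\<close>, whose integral is 1, only where the
  weight is positive; elsewhere all \<open>\<phi> j\<close> vanish, and large values of \<open>v\<close> do not contribute.
\<close>
lemma abs_inner_phi_le_1:
  assumes v: "v \<in> L2_space \<mu>" and le: "wsup_norm \<mu> \<phi> v \<le> 1"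
  shows "\<bar>L2_inner \<mu> v (\<phi> j)\<bar> \<le> 1"
proof -
  have "\<bar>v x * \<phi> j x\<bar> \<le> (inverse (weight \<phi> x) + (\<phi> j x)\<^sup>2) / 2" if x: "x \<in> space \<mu>" for x
  proof (cases "weight \<phi> x = 0")
    case True
    then show ?thesis by (simp add: weight_eq_0_iff weight_nonneg)
  next
    case False
    then have w: "0 < weight \<phi> x" using weight_nonneg[of \<phi> x] by simp
    have "sqrt (weight \<phi> x) * \<bar>v x\<bar> \<le> 1"
      using le x wsup_norm_le_iff[of \<mu> \<phi> v 1] by (simp add: one_ereal_def)
    then have "(sqrt (weight \<phi> x) * \<bar>v x\<bar>)\<^sup>2 \<le> 1" by (intro power_le_one) (auto simp: weight_nonneg)
    then have "(v x)\<^sup>2 \<le> inverse (weight \<phi> x)" using w by (simp add: power_mult_distrib field_simps)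
    moreover have "2 * (\<bar>v x\<bar> * \<bar>\<phi> j x\<bar>) \<le> (v x)\<^sup>2 + (\<phi> j x)\<^sup>2"
      using sum_squares_bound[of "\<bar>v x\<bar>" "\<bar>\<phi> j x\<bar>"] by simp
    moreover have "s \<le> (w + t) / 2" if "r \<le> w" "2 * s \<le> r + t" for r s t w :: real
      using that by simp
    ultimately show ?thesis unfolding abs_mult by blast
  qed
  then have "(\<integral>x. \<bar>v x * \<phi> j x\<bar> \<partial>\<mu>) \<le> (\<integral>x. (inverse (weight \<phi> x) + (\<phi> j x)\<^sup>2) / 2 \<partial>\<mu>)"
    using integrable_mult_L2[OF v phi_L2] integrable_inverse_weight phi_square_integrable
    by (intro integral_mono) auto
  also have "\<dots> = 1"
    using integrable_inverse_weight phi_square_integrable integral_phi_mult[of j j]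
    by (simp add: integral_inverse_weight power2_eq_square)
  finally show ?thesis
    unfolding L2_inner_def using integral_abs_bound[of \<mu> "\<lambda>x. v x * \<phi> j x"] by linarith
qed

lemma wsup_norm_L2_proj_le:
  assumes v: "v \<in> L2_space \<mu>" and le: "wsup_norm \<mu> \<phi> v \<le> 1"
  shows "wsup_norm \<mu> \<phi> (L2_proj \<mu> \<phi> v) \<le> ereal (sqrt CARD('m) * CARD('m))"
  unfolding wsup_norm_le_iff
proof
  fix x
  have "norm (proj_coeffs v) \<le> (\<Sum>j\<in>UNIV. \<bar>proj_coeffs v $ j\<bar>)" by (rule norm_le_l1_cart)
  also have "\<dots> \<le> CARD('m)"
    using sum_bounded_above[of UNIV "\<lambda>j. \<bar>proj_coeffs v $ j\<bar>" 1] abs_inner_phi_le_1[OF v le]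
    by (simp add: proj_coeffs_def)
  finally have p: "norm (proj_coeffs v) \<le> CARD('m)" .
  have "sqrt (weight \<phi> x) * \<bar>L2_proj \<mu> \<phi> v x\<bar> = \<bar>sqrt (weight \<phi> x) * lincomb \<phi> (proj_coeffs v) x\<bar>"
    by (simp add: abs_mult weight_nonneg L2_proj_eq_lincomb)
  also have "\<dots> = sqrt CARD('m) * \<bar>feature \<phi> x \<bullet> proj_coeffs v\<bar>" by (simp add: weighted_lincomb abs_mult)
  also have "\<dots> \<le> sqrt CARD('m) * (norm (feature \<phi> x) * norm (proj_coeffs v))"
    by (intro mult_left_mono Cauchy_Schwarz_ineq2) auto
  also have "\<dots> \<le> sqrt CARD('m) * (1 * CARD('m))"
    using p by (intro mult_left_mono mult_mono) (auto simp: norm_feature)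
  finally show "sqrt (weight \<phi> x) * \<bar>L2_proj \<mu> \<phi> v x\<bar> \<le> sqrt CARD('m) * CARD('m)" by simp
qed

text \<open>
  The crude bound of \<open>wsup_norm_L2_proj_le\<close> serves to exclude an infinite supremum, for which
  \<open>real_of_ereal\<close> would return 0.
\<close>
lemma proj_const_bound:
  shows "0 \<le> proj_const \<mu> \<phi>"
    and "v \<in> L2_space \<mu> \<Longrightarrow> wsup_norm \<mu> \<phi> v \<le> 1 \<Longrightarrow>
      wsup_norm \<mu> \<phi> (L2_proj \<mu> \<phi> v) \<le> ereal (proj_const \<mu> \<phi>)"
proof -
  let ?A = "{v \<in> L2_space \<mu>. wsup_norm \<mu> \<phi> v \<le> 1}"
  let ?S = "SUP v\<in>?A. wsup_norm \<mu> \<phi> (L2_proj \<mu> \<phi> v)"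
  have "(\<lambda>x. 0) \<in> ?A" by (simp add: L2_space_def wsup_norm_le_iff[of _ _ _ 1, folded one_ereal_def])
  then have ge: "0 \<le> ?S" using wsup_norm_nonneg by (rule SUP_upper2)
  have "?S \<le> ereal (sqrt CARD('m) * CARD('m))" by (intro SUP_least wsup_norm_L2_proj_le) auto
  with ge have "\<bar>?S\<bar> \<noteq> \<infinity>" by (cases ?S) auto
  then have S: "ereal (proj_const \<mu> \<phi>) = ?S" unfolding proj_const_def by (rule ereal_real')
  show "0 \<le> proj_const \<mu> \<phi>" using ge unfolding S[symmetric] by simp
  show "wsup_norm \<mu> \<phi> (L2_proj \<mu> \<phi> v) \<le> ereal (proj_const \<mu> \<phi>)"
    if "v \<in> L2_space \<mu>" "wsup_norm \<mu> \<phi> v \<le> 1"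
    unfolding S using that by (intro SUP_upper) auto
qed

text \<open>
  Homogeneity.  The case \<open>L = 0\<close> uses that every multiple of \<open>u\<close> is then admissible in the
  supremum.
\<close>
lemma wsup_norm_L2_proj_le_mult:
  assumes u: "u \<in> L2_space \<mu>" and le: "wsup_norm \<mu> \<phi> u \<le> ereal L" and x: "x \<in> space \<mu>"
  shows "sqrt (weight \<phi> x) * \<bar>L2_proj \<mu> \<phi> u x\<bar> \<le> L * proj_const \<mu> \<phi>"
proof -
  let ?c = "proj_const \<mu> \<phi>"
  have L: "0 \<le> L" using order_trans[OF wsup_norm_nonneg le] by simp
  have scaled: "t * (sqrt (weight \<phi> x) * \<bar>L2_proj \<mu> \<phi> u x\<bar>) \<le> ?c" if t: "0 \<le> t" "t * L \<le> 1" for t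
  proof -
    let ?v = "\<lambda>x. t * u x"
    have v: "?v \<in> L2_space \<mu>" using u by (auto simp: L2_space_def power_mult_distrib)
    have "sqrt (weight \<phi> y) * \<bar>?v y\<bar> \<le> 1" if "y \<in> space \<mu>" for y
    proof -
      have "t * (sqrt (weight \<phi> y) * \<bar>u y\<bar>) \<le> t * L"
        using le that t by (intro mult_left_mono) (auto simp: wsup_norm_le_iff)
      then show ?thesis using t by (simp add: abs_mult ac_simps)
    qed
    then have "wsup_norm \<mu> \<phi> ?v \<le> 1" by (simp add: wsup_norm_le_iff[of _ _ _ 1, folded one_ereal_def])
    from proj_const_bound(2)[OF v this] have "sqrt (weight \<phi> x) * \<bar>L2_proj \<mu> \<phi> ?v x\<bar> \<le> ?c"
      using x by (simp add: wsup_norm_le_iff)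
    moreover have "L2_proj \<mu> \<phi> ?v x = t * L2_proj \<mu> \<phi> u x"
      by (simp add: L2_proj_def L2_inner_def sum_distrib_left mult.assoc)
    ultimately show ?thesis using t by (simp add: abs_mult ac_simps)
  qed
  show ?thesis
  proof (cases "L = 0")
    case False
    then show ?thesis using scaled[of "1 / L"] L by (simp add: field_simps)
  next
    case True
    define r where "r = sqrt (weight \<phi> x) * \<bar>L2_proj \<mu> \<phi> u x\<bar>"
    have "r \<le> 0"
    proof (rule ccontr)
      assume "\<not> r \<le> 0"
      then show False
        using scaled[of "(?c + 1) / r", folded r_def] True proj_const_bound(1) by simp
    qed
    then show ?thesis using True by (simp add: r_def)
  qed
qed

lemma weighted_residual_le:
  assumes u: "u \<in> L2_space \<mu>" and le: "wsup_norm \<mu> \<phi> u \<le> ereal L" and x: "x \<in> space \<mu>"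
  shows "(sqrt (weight \<phi> x) * (u x - L2_proj \<mu> \<phi> u x))\<^sup>2 \<le> (L * (1 + proj_const \<mu> \<phi>))\<^sup>2"
proof -
  have "\<bar>sqrt (weight \<phi> x) * (u x - L2_proj \<mu> \<phi> u x)\<bar>
      \<le> sqrt (weight \<phi> x) * \<bar>u x\<bar> + sqrt (weight \<phi> x) * \<bar>L2_proj \<mu> \<phi> u x\<bar>"
    using mult_left_mono[OF abs_triangle_ineq4[of "u x" "L2_proj \<mu> \<phi> u x"], of "sqrt (weight \<phi> x)"]
    by (simp add: abs_mult weight_nonneg distrib_left)
  also have "\<dots> \<le> L + L * proj_const \<mu> \<phi>"
    using le x by (intro add_mono wsup_norm_L2_proj_le_mult[OF u le]) (auto simp: wsup_norm_le_iff)
  finally have "\<bar>sqrt (weight \<phi> x) * (u x - L2_proj \<mu> \<phi> u x)\<bar> \<le> L * (1 + proj_const \<mu> \<phi>)"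
    by (simp add: distrib_left)
  then have "\<bar>sqrt (weight \<phi> x) * (u x - L2_proj \<mu> \<phi> u x)\<bar>\<^sup>2 \<le> (L * (1 + proj_const \<mu> \<phi>))\<^sup>2"
    by (intro power_mono) auto
  then show ?thesis by simp
qed

lemma space_rho_n: "x \<in> space (rho_n \<mu> \<phi> n) \<Longrightarrow> i \<in> {1..n} \<Longrightarrow> x i \<in> space \<mu>"
  by (auto simp: rho_n_def space_PiM)

lemma prob_space_rho_n: "prob_space (rho_n \<mu> \<phi> n)"
  unfolding rho_n_def by (rule prob_space_PiM) (rule prob_space_rho)

lemma emp_norm_measurable:
  assumes [measurable]: "g \<in> borel_measurable \<mu>"
  shows "(\<lambda>x. (emp_norm \<phi> x {1..n} g)\<^sup>2) \<in> borel_measurable (rho_n \<mu> \<phi> n)"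
proof -
  have [measurable]: "(\<lambda>t. (sqrt (weight \<phi> t) * g t)\<^sup>2) \<in> borel_measurable (rho \<mu> \<phi>)" by measurable
  show ?thesis
    unfolding emp_norm_square rho_n_def
    by (intro borel_measurable_times borel_measurable_const borel_measurable_sum
        measurable_compose[OF measurable_component_singleton]) measurable
qed

text \<open>
  In expectation the empirical norm sees exactly the part of \<open>g\<close> where the weight is positive,
  since there the density \<open>inverse (weight \<phi> x)\<close> cancels the weight.
\<close>
lemma nn_integral_emp_norm_le:
  assumes g[measurable]: "g \<in> borel_measurable \<mu>" and "integrable \<mu> (\<lambda>x. (g x)\<^sup>2)" and n: "0 < n"
  shows "(\<integral>\<^sup>+x. ennreal ((emp_norm \<phi> x {1..n} g)\<^sup>2) \<partial>rho_n \<mu> \<phi> n) \<le> ennreal ((L2_norm \<mu> g)\<^sup>2)"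
proof -
  let ?f = "\<lambda>t. ennreal ((sqrt (weight \<phi> t) * g t)\<^sup>2)"
  have f: "?f \<in> borel_measurable (rho \<mu> \<phi>)" by measurable
  have comp: "(\<lambda>x. ?f (x i)) \<in> borel_measurable (rho_n \<mu> \<phi> n)" if "i \<in> {1..n}" for i
    unfolding rho_n_def by (rule measurable_compose[OF measurable_component_singleton[OF that] f])
  have one: "(\<integral>\<^sup>+t. ?f t \<partial>rho \<mu> \<phi>) \<le> ennreal ((L2_norm \<mu> g)\<^sup>2)"
  proof -
    have "(\<integral>\<^sup>+t. ?f t \<partial>rho \<mu> \<phi>) = (\<integral>\<^sup>+t. ennreal (inverse (weight \<phi> t)) * ?f t \<partial>\<mu>)"
      by (rule nn_integral_rho) measurable
    also have "\<dots> \<le> (\<integral>\<^sup>+t. ennreal ((g t)\<^sup>2) \<partial>\<mu>)"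
    proof (rule nn_integral_mono)
      fix t
      have "inverse (weight \<phi> t) * (sqrt (weight \<phi> t) * g t)\<^sup>2 \<le> (g t)\<^sup>2"
        by (cases "weight \<phi> t = 0") (simp_all add: power_mult_distrib weight_nonneg flip: mult.assoc)
      then show "ennreal (inverse (weight \<phi> t)) * ?f t \<le> ennreal ((g t)\<^sup>2)"
        by (simp add: weight_nonneg ennreal_leI flip: ennreal_mult)
    qed
    also have "\<dots> = ennreal ((L2_norm \<mu> g)\<^sup>2)"
      using assms(2) by (simp add: L2_norm_def nn_integral_eq_integral)
    finally show ?thesis .
  qed
  have "(\<integral>\<^sup>+x. ennreal ((emp_norm \<phi> x {1..n} g)\<^sup>2) \<partial>rho_n \<mu> \<phi> n)
      = (\<integral>\<^sup>+x. ennreal (1 / n) * (\<Sum>i=1..n. ?f (x i)) \<partial>rho_n \<mu> \<phi> n)"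
    unfolding emp_norm_square by (simp add: sum_nonneg flip: ennreal_mult)
  also have "\<dots> = ennreal (1 / n) * (\<Sum>i=1..n. (\<integral>\<^sup>+x. ?f (x i) \<partial>rho_n \<mu> \<phi> n))"
  proof -
    have "(\<integral>\<^sup>+x. ennreal (1 / n) * (\<Sum>i=1..n. ?f (x i)) \<partial>rho_n \<mu> \<phi> n)
        = ennreal (1 / n) * (\<integral>\<^sup>+x. (\<Sum>i=1..n. ?f (x i)) \<partial>rho_n \<mu> \<phi> n)"
      by (intro nn_integral_cmult borel_measurable_sum comp)
    also have "(\<integral>\<^sup>+x. (\<Sum>i=1..n. ?f (x i)) \<partial>rho_n \<mu> \<phi> n)
        = (\<Sum>i=1..n. (\<integral>\<^sup>+x. ?f (x i) \<partial>rho_n \<mu> \<phi> n))"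
      by (intro nn_integral_sum comp)
    finally show ?thesis .
  qed
  also have "\<dots> = ennreal (1 / n) * (\<Sum>i=1..n. (\<integral>\<^sup>+t. ?f t \<partial>rho \<mu> \<phi>))"
  proof (intro arg_cong2[where f = "(*)"] sum.cong refl)
    fix i assume i: "i \<in> {1..n}"
    have "(\<integral>\<^sup>+t. ?f t \<partial>rho \<mu> \<phi>) = (\<integral>\<^sup>+t. ?f t \<partial>distr (rho_n \<mu> \<phi> n) (rho \<mu> \<phi>) (\<lambda>x. x i))"
      unfolding rho_n_def using i prob_space_rho by (subst distr_PiM_component) auto
    also have "\<dots> = (\<integral>\<^sup>+x. ?f (x i) \<partial>rho_n \<mu> \<phi> n)"
      unfolding rho_n_def using i f by (subst nn_integral_distr) auto
    finally show "(\<integral>\<^sup>+x. ?f (x i) \<partial>rho_n \<mu> \<phi> n) = (\<integral>\<^sup>+t. ?f t \<partial>rho \<mu> \<phi>)" by simp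
  qed
  also have "\<dots> \<le> ennreal (1 / n) * (\<Sum>i=1..n. ennreal ((L2_norm \<mu> g)\<^sup>2))"
    by (intro mult_left_mono sum_mono one) auto
  also have "\<dots> = ennreal (1 / n) * (ennreal n * ennreal ((L2_norm \<mu> g)\<^sup>2))"
    by (simp add: ennreal_of_nat_eq_real_of_nat)
  also have "\<dots> = ennreal (1 / n * (n * (L2_norm \<mu> g)\<^sup>2))"
    by (simp flip: ennreal_mult)
  also have "1 / n * (n * (L2_norm \<mu> g)\<^sup>2) = (L2_norm \<mu> g)\<^sup>2" using n by simp
  finally show ?thesis .
qed

end

theorem theorem3p9:
  fixes X :: "'a::euclidean_space set"
    and \<mu> :: "'a measure"
    and \<phi> :: "'m::finite \<Rightarrow> 'a \<Rightarrow> real"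
    and u :: "'a \<Rightarrow> real"
    and M n n\<^sub>m\<^sub>i\<^sub>n :: nat
    and \<delta> \<eta> :: real
    and \<Omega> :: "'b measure"
    and xt :: "'b \<Rightarrow> nat \<Rightarrow> 'a"
    and K :: "'b \<Rightarrow> nat set"
  assumes "prob_space \<mu>" and "space \<mu> = X"
    and "L2_orthonormal \<mu> \<phi>"
    and "u \<in> L2_space \<mu>"
    and "M \<ge> 1"
    and "n\<^sub>m\<^sub>i\<^sub>n \<in> {1..n}"
    and "0 < \<delta>" and "\<delta> < 1"
    and "0 < \<eta>" and "\<eta> < 1"
    and "real n \<ge> n_bound \<delta> \<eta> CARD('m)"
    and "prob_space \<Omega>"
    and "xt \<in> measurable \<Omega> (rho_n \<mu> \<phi> n)"
    and "distr \<Omega> (rho_n \<mu> \<phi> n) xt = rho_tilde \<mu> \<phi> n M \<delta>"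
    and "K \<in> measurable \<Omega> (count_space UNIV)"
    and "AE \<omega> in \<Omega>. greedy_output \<phi> \<delta> n\<^sub>m\<^sub>i\<^sub>n n (xt \<omega>) (K \<omega>)"
  shows
    "(\<integral>\<^sup>+\<omega>. ennreal ((L2_norm \<mu> (\<lambda>x. u x - lsq_proj \<phi> (xt \<omega>) (K \<omega>) u x))\<^sup>2) \<partial>\<Omega>)
       \<le> ennreal ((1 + real n / real n\<^sub>m\<^sub>i\<^sub>n * inverse (1 - \<delta>) * inverse (1 - \<eta> ^ M) * real M)
            * (L2_norm \<mu> (\<lambda>x. u x - L2_proj \<mu> \<phi> u x))\<^sup>2)
     \<and> (\<forall>L::real. wsup_norm \<mu> \<phi> u \<le> ereal L \<longrightarrow>
         (\<integral>\<^sup>+\<omega>. ennreal ((L2_norm \<mu> (\<lambda>x. u x - lsq_proj \<phi> (xt \<omega>) (K \<omega>) u x))\<^sup>2) \<partial>\<Omega>)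
           \<le> ennreal ((L2_norm \<mu> (\<lambda>x. u x - L2_proj \<mu> \<phi> u x))\<^sup>2
                + real n / real n\<^sub>m\<^sub>i\<^sub>n * inverse (1 - \<delta>) * inverse (1 - \<eta> ^ M)
                  * D_const M L (proj_const \<mu> \<phi>) ((L2_norm \<mu> (\<lambda>x. u x - L2_proj \<mu> \<phi> u x))\<^sup>2)))"
proof -
  interpret orthonormal_system \<mu> \<phi>
    using assms(1,3) by (simp add: orthonormal_system_def orthonormal_system_axioms_def)
  interpret \<Omega>: prob_space \<Omega> by fact
  have n: "0 < n" and nmin: "0 < n\<^sub>m\<^sub>i\<^sub>n" "n\<^sub>m\<^sub>i\<^sub>n \<le> n" using assms(6) by auto
  define Q where "Q = rho_n \<mu> \<phi> n"
  define Z where "Z = (\<lambda>x. Zdev \<phi> x {1..n})"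
  interpret Q: prob_space Q unfolding Q_def by (rule prob_space_rho_n)
  have "Z \<in> borel_measurable Q" unfolding Z_def Q_def rho_n_def by (rule Zdev_measurable)
  then interpret best: best_of_iid Q Z M
    using assms(5) Q.prob_space_axioms by (simp add: best_of_iid_def best_of_iid_axioms_def)
  have law: "rho_tilde \<mu> \<phi> n M \<delta> = best.cond_law \<delta>"
  proof -
    have Z_eq: "Zdev \<phi> x {1..n} = Z x" for x by (simp add: Z_def)
    show ?thesis
      unfolding rho_tilde_def rho_star_def best_indices_def Q_def[symmetric] Z_eq
        best.cond_law_def best.best_law_def best.pick_def[abs_def] best.best_def ..
  qed
  define g where "g = (\<lambda>x. u x - L2_proj \<mu> \<phi> u x)"
  define \<alpha> where "\<alpha> = (L2_norm \<mu> g)\<^sup>2"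
  define Y where "Y = (\<lambda>x. (emp_norm \<phi> x {1..n} g)\<^sup>2)"
  define \<kappa> where "\<kappa> = real n / real n\<^sub>m\<^sub>i\<^sub>n * inverse (1 - \<delta>)"
  define p where "p = inverse (1 - \<eta> ^ M)"
  let ?err = "\<integral>\<^sup>+\<omega>. ennreal ((L2_norm \<mu> (\<lambda>x. u x - lsq_proj \<phi> (xt \<omega>) (K \<omega>) u x))\<^sup>2) \<partial>\<Omega>"
  have g: "g \<in> borel_measurable \<mu>"
  proof -
    have [measurable]: "u \<in> borel_measurable \<mu>" using assms(4) by (simp add: L2_space_def)
    show ?thesis unfolding g_def L2_proj_def by measurable
  qed
  have g2: "integrable \<mu> (\<lambda>x. (g x)\<^sup>2)"
    using integral_diff_lincomb_square(1)[OF assms(4)] by (simp add: g_def L2_proj_eq_lincomb)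
  have Y: "Y \<in> borel_measurable Q" unfolding Y_def Q_def by (rule emp_norm_measurable[OF g])
  have Y0: "0 \<le> Y x" for x by (simp add: Y_def)
  have \<alpha>: "0 \<le> \<alpha>" by (simp add: \<alpha>_def)
  have \<kappa>: "0 \<le> \<kappa>" using assms(8) by (simp add: \<kappa>_def)
  have \<eta>M: "\<eta> ^ M < 1" using assms(5,9,10) by (simp add: power_less_one_iff)
  then have p: "0 \<le> p" by (simp add: p_def)
  have EY: "(\<integral>\<^sup>+x. ennreal (Y x) \<partial>Q) \<le> ennreal \<alpha>"
    unfolding Y_def Q_def \<alpha>_def by (rule nn_integral_emp_norm_le[OF g g2 n])
  have cond: "(\<integral>\<^sup>+x. ennreal (Y x) \<partial>best.cond_law \<delta>) \<le> ennreal p * (\<integral>\<^sup>+x. ennreal (Y x) \<partial>best.best_law)"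
    unfolding p_def
  proof (rule best.nn_integral_cond_law_le)
    show "Q.prob {x \<in> space Q. \<delta> < Z x} \<le> \<eta>"
      unfolding Q_def Z_def by (rule prob_Zdev_gt_le[OF assms(7-11) n])
  qed (use Y assms(10) in auto)
  have xt: "xt \<in> measurable \<Omega> Q" using assms(13) by (simp add: Q_def)
  have distr: "distr \<Omega> Q xt = best.cond_law \<delta>" using assms(14) by (simp add: Q_def law)
  have "AE x in distr \<Omega> Q xt. Z x \<le> \<delta>" unfolding distr by (rule best.AE_cond_law)
  then have "AE \<omega> in \<Omega>. Z (xt \<omega>) \<le> \<delta>"
    by (subst (asm) AE_distr_iff[OF xt]) auto
  with assms(16) have "AE \<omega> in \<Omega>. (L2_norm \<mu> (\<lambda>x. u x - lsq_proj \<phi> (xt \<omega>) (K \<omega>) u x))\<^sup>2 \<le> \<alpha> + \<kappa> * Y (xt \<omega>)"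
  proof eventually_elim
    case (elim \<omega>)
    note inv = greedy_output_invariant[OF elim(1) elim(2)[unfolded Z_def] nmin(2)]
    have "(L2_norm \<mu> (\<lambda>x. u x - lsq_proj \<phi> (xt \<omega>) (K \<omega>) u x))\<^sup>2
        \<le> \<alpha> + inverse (1 - \<delta>) * (emp_norm \<phi> (xt \<omega>) (K \<omega>) g)\<^sup>2"
      unfolding \<alpha>_def g_def by (rule lsq_proj_error_le[OF assms(4) inv(3) assms(8)])
    also have "\<dots> \<le> \<alpha> + inverse (1 - \<delta>) * (real n / real n\<^sub>m\<^sub>i\<^sub>n * Y (xt \<omega>))"
      using emp_norm_square_subset_le[OF inv(1) _ nmin(1) inv(2), of \<phi> "xt \<omega>" g] assms(8)
      by (intro add_left_mono mult_left_mono) (auto simp: Y_def)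
    finally show ?case by (simp add: \<kappa>_def ac_simps)
  qed
  then have "?err \<le> (\<integral>\<^sup>+\<omega>. ennreal (\<alpha> + \<kappa> * Y (xt \<omega>)) \<partial>\<Omega>)"
    by (intro nn_integral_mono_AE) (auto elim!: eventually_mono intro: ennreal_leI)
  also have "\<dots> = (\<integral>\<^sup>+x. ennreal (\<alpha> + \<kappa> * Y x) \<partial>distr \<Omega> Q xt)"
    using Y xt by (subst nn_integral_distr) auto
  also have "\<dots> = (\<integral>\<^sup>+x. ennreal \<alpha> + ennreal \<kappa> * ennreal (Y x) \<partial>distr \<Omega> Q xt)"
    using \<alpha> \<kappa> Y0 by (simp add: ennreal_mult)
  also have "\<dots> = ennreal \<alpha> * emeasure (distr \<Omega> Q xt) (space (distr \<Omega> Q xt))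
      + ennreal \<kappa> * (\<integral>\<^sup>+x. ennreal (Y x) \<partial>distr \<Omega> Q xt)"
    using Y by (simp add: nn_integral_add nn_integral_cmult)
  also have "emeasure (distr \<Omega> Q xt) (space (distr \<Omega> Q xt)) = 1"
    by (rule prob_space.emeasure_space_1[OF \<Omega>.prob_space_distr[OF xt]])
  also have "ennreal \<alpha> * 1 + ennreal \<kappa> * (\<integral>\<^sup>+x. ennreal (Y x) \<partial>distr \<Omega> Q xt)
      \<le> ennreal \<alpha> + ennreal \<kappa> * (ennreal p * (\<integral>\<^sup>+x. ennreal (Y x) \<partial>best.best_law))"
    unfolding distr using cond by (auto intro!: add_mono mult_left_mono)
  finally have err: "?err \<le> ennreal \<alpha> + ennreal \<kappa> * (ennreal p * (\<integral>\<^sup>+x. ennreal (Y x) \<partial>best.best_law))" .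
  have bound: "?err \<le> ennreal (\<alpha> + \<kappa> * p * s)"
    if s: "0 \<le> s" "(\<integral>\<^sup>+x. ennreal (Y x) \<partial>best.best_law) \<le> ennreal s" for s
  proof -
    have "?err \<le> ennreal \<alpha> + ennreal \<kappa> * (ennreal p * ennreal s)"
      by (rule order_trans[OF err]) (intro add_mono mult_left_mono s order_refl zero_le)
    also have "\<dots> = ennreal (\<alpha> + \<kappa> * p * s)"
      using \<alpha> \<kappa> p s(1) by (simp add: ennreal_mult mult.assoc)
    finally show ?thesis .
  qed
  have first: "?err \<le> ennreal (\<alpha> + \<kappa> * p * (real M * \<alpha>))"
  proof (rule bound)
    have "(\<integral>\<^sup>+x. ennreal (Y x) \<partial>best.best_law) \<le> of_nat M * (\<integral>\<^sup>+x. ennreal (Y x) \<partial>Q)"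
      using Y by (intro best.nn_integral_best_law_le_sum) auto
    also have "\<dots> \<le> of_nat M * ennreal \<alpha>" by (intro mult_left_mono EY) auto
    also have "\<dots> = ennreal (real M * \<alpha>)" using \<alpha> by (simp add: ennreal_mult ennreal_of_nat_eq_real_of_nat)
    finally show "(\<integral>\<^sup>+x. ennreal (Y x) \<partial>best.best_law) \<le> ennreal (real M * \<alpha>)" .
  qed (use \<alpha> in simp)
  have second: "?err \<le> ennreal (\<alpha> + \<kappa> * p * D_const M L (proj_const \<mu> \<phi>) \<alpha>)"
    if L: "wsup_norm \<mu> \<phi> u \<le> ereal L" for L
  proof -
    let ?l = "L * (1 + proj_const \<mu> \<phi>)" and ?a = "\<integral>x. Y x \<partial>Q"
    let ?B = "?l\<^sup>2"
    have l: "0 \<le> ?l"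
      using order_trans[OF wsup_norm_nonneg L] proj_const_bound(1) by simp
    have YB: "Y x \<le> ?B" if x: "x \<in> space Q" for x
    proof -
      have "(\<Sum>i=1..n. (sqrt (weight \<phi> (x i)) * g (x i))\<^sup>2) \<le> n * ?B"
        using sum_bounded_above[of "{1..n}" "\<lambda>i. (sqrt (weight \<phi> (x i)) * g (x i))\<^sup>2" ?B]
          weighted_residual_le[OF assms(4) L space_rho_n[OF x[unfolded Q_def]]]
        by (simp add: g_def)
      then show ?thesis using n by (simp add: Y_def emp_norm_square divide_le_eq mult.commute)
    qed
    have intY: "integrable Q Y"
      using Y Y0 YB by (intro Q.integrable_const_bound[of _ ?B]) auto
    have a: "0 \<le> ?a" "?a \<le> \<alpha>" "?a \<le> ?B"
    proof -
      show "0 \<le> ?a" using Y0 by simp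
      have "ennreal ?a \<le> ennreal \<alpha>" using EY nn_integral_eq_integral[OF intY] Y0 by simp
      then show "?a \<le> \<alpha>" using \<alpha> by simp
      have "?a \<le> (\<integral>x. ?B \<partial>Q)" using intY YB by (intro integral_mono) auto
      then show "?a \<le> ?B" by (simp add: Q.prob_space)
    qed
    let ?s = "?B * (1 - (1 - ?a / ?B) ^ M)"
    have "0 \<le> 1 - ?a / ?B \<and> 1 - ?a / ?B \<le> 1" using a by (auto simp: divide_le_eq)
    then have s: "0 \<le> ?s" by (simp add: power_le_one)
    have "?err \<le> ennreal (\<alpha> + \<kappa> * p * ?s)"
    proof (rule bound[OF s])
      show "(\<integral>\<^sup>+x. ennreal (Y x) \<partial>best.best_law) \<le> ennreal ?s"
      proof (cases "?B = 0")
        case False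
        then show ?thesis using Y Y0 YB by (intro best.nn_integral_best_law_bounded_le) auto
      next
        case True
        then have "Y x = 0" if "x \<in> space best.best_law" for x
          using YB[of x] Y0[of x] that unfolding True by simp
        then have "(\<integral>\<^sup>+x. ennreal (Y x) \<partial>best.best_law) = (\<integral>\<^sup>+x. 0 \<partial>best.best_law)"
          by (intro nn_integral_cong) simp
        then show ?thesis by simp
      qed
    qed
    also have "\<dots> \<le> ennreal (\<alpha> + \<kappa> * p * D_const M L (proj_const \<mu> \<phi>) \<alpha>)"
      using \<kappa> p by (intro ennreal_leI add_left_mono mult_left_mono D_const_ge l a assms(5)) auto
    finally show ?thesis .
  qed
  show ?thesis
    using first second unfolding \<kappa>_def p_def \<alpha>_def g_def by (auto simp: algebra_simps)
qed

end
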